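(* There is an algorithm which, given a cograph $G$ with $n$ vertices, computes the exact number of perfect matchings of $G$ in time $O(n^4)$.
   Context: For vertex-disjoint graphs $G=(V,E)$, $H=(W,F)$, the disjoint union is $(V\cup W,E\cup F)$ and the complete join is $(V\cup W,E\cup F\cup\{vw: v\in V,w\in W\})$. A cograph is a graph that is either a single vertex, or the disjoint union of two cographs, or the complete join of two cographs. Time is measured with arithmetic operations on integers counted at unit cost. *)

theory Defs
  imports Complex_Main "HOL-Library.Landau_Symbols"
begin

section \<open>Cographs and perfect matchings\<close>

type_synonym 'a graph = "'a set \<times> 'a set set"

abbreviation verts :: "'a graph \<Rightarrow> 'a set" where
  "verts \<equiv> fst"

abbreviation edges :: "'a graph \<Rightarrow> 'a set set" where
  "edges \<equiv> snd"

definition disjoint_union :: "'a graph \<Rightarrow> 'a graph \<Rightarrow> 'a graph" where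
  "disjoint_union G H = (verts G \<union> verts H, edges G \<union> edges H)"

definition complete_join :: "'a graph \<Rightarrow> 'a graph \<Rightarrow> 'a graph" where
  "complete_join G H =
    (verts G \<union> verts H, edges G \<union> edges H \<union> {{v, w} | v w. v \<in> verts G \<and> w \<in> verts H})"

inductive cograph :: "'a graph \<Rightarrow> bool" where
  single: "cograph ({v}, {})"
| union: "cograph G \<Longrightarrow> cograph H \<Longrightarrow> verts G \<inter> verts H = {} \<Longrightarrow> cograph (disjoint_union G H)"
| join: "cograph G \<Longrightarrow> cograph H \<Longrightarrow> verts G \<inter> verts H = {} \<Longrightarrow> cograph (complete_join G H)"

definition perfect_matching :: "'a graph \<Rightarrow> 'a set set \<Rightarrow> bool" where
  "perfect_matching G M \<longleftrightarrow> M \<subseteq> edges G \<and> (\<forall>v\<in>verts G. \<exists>!e. e \<in> M \<and> v \<in> e)"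

definition num_perfect_matchings :: "'a graph \<Rightarrow> nat" where
  "num_perfect_matchings G = card {M. perfect_matching G M}"


section \<open>Unit-cost integer programs\<close>

text \<open>
  The machine model is a random access machine, presented as a structured language.  The memory
  consists of integer arrays, addressed by name and by a computed index; a scalar variable is
  entry 0 of an array.  A program mentions only finitely many array names, so the arrays can be
  interleaved into the single memory of a random access machine with constant overhead.
  Integers are unbounded, and every constant, memory access, arithmetic operation, comparison,
  Boolean connective and control step costs one unit.  The arithmetic operations are addition,
  subtraction and multiplication; division is deliberately absent, since on unbounded integers
  at unit cost it would make the model stronger.
\<close>

type_synonym vname = string
type_synonym state = "vname \<Rightarrow> int \<Rightarrow> int"

datatype aexp =
    Const int
  | Read vname aexp
  | Add aexp aexp
  | Sub aexp aexp
  | Mul aexp aexp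

datatype bexp =
    Less aexp aexp
  | Equal aexp aexp
  | Neg bexp
  | Conj bexp bexp

datatype com =
    Skip
  | Write vname aexp aexp
  | Seq com com
  | Cond bexp com com
  | While bexp com

fun aval :: "aexp \<Rightarrow> state \<Rightarrow> int" where
  "aval (Const k) s = k"
| "aval (Read x a) s = s x (aval a s)"
| "aval (Add a b) s = aval a s + aval b s"
| "aval (Sub a b) s = aval a s - aval b s"
| "aval (Mul a b) s = aval a s * aval b s"

fun acost :: "aexp \<Rightarrow> nat" where
  "acost (Const k) = 1"
| "acost (Read x a) = 1 + acost a"
| "acost (Add a b) = 1 + acost a + acost b"
| "acost (Sub a b) = 1 + acost a + acost b"
| "acost (Mul a b) = 1 + acost a + acost b"

fun bval :: "bexp \<Rightarrow> state \<Rightarrow> bool" where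
  "bval (Less a b) s \<longleftrightarrow> aval a s < aval b s"
| "bval (Equal a b) s \<longleftrightarrow> aval a s = aval b s"
| "bval (Neg b) s \<longleftrightarrow> \<not> bval b s"
| "bval (Conj b c) s \<longleftrightarrow> bval b s \<and> bval c s"

fun bcost :: "bexp \<Rightarrow> nat" where
  "bcost (Less a b) = 1 + acost a + acost b"
| "bcost (Equal a b) = 1 + acost a + acost b"
| "bcost (Neg b) = 1 + bcost b"
| "bcost (Conj b c) = 1 + bcost b + bcost c"

text \<open>
  \<open>exec c s t s'\<close>: started in state \<open>s\<close>, the program \<open>c\<close> terminates in state \<open>s'\<close> after
  exactly \<open>t\<close> unit-cost steps.
\<close>

inductive exec :: "com \<Rightarrow> state \<Rightarrow> nat \<Rightarrow> state \<Rightarrow> bool" where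
  Skip: "exec Skip s 1 s"
| Write: "exec (Write x a b) s (1 + acost a + acost b)
            (s(x := (s x)(aval a s := aval b s)))"
| Seq: "exec c s t s' \<Longrightarrow> exec d s' u s'' \<Longrightarrow> exec (Seq c d) s (t + u) s''"
| CondTrue: "bval b s \<Longrightarrow> exec c s t s' \<Longrightarrow> exec (Cond b c d) s (1 + bcost b + t) s'"
| CondFalse: "\<not> bval b s \<Longrightarrow> exec d s t s' \<Longrightarrow> exec (Cond b c d) s (1 + bcost b + t) s'"
| WhileFalse: "\<not> bval b s \<Longrightarrow> exec (While b c) s (1 + bcost b) s"
| WhileTrue: "bval b s \<Longrightarrow> exec c s t s' \<Longrightarrow> exec (While b c) s' u s'' \<Longrightarrow>
    exec (While b c) s (1 + bcost b + t + u) s''"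

lemma exec_deterministic:
  "exec c s t s' \<Longrightarrow> exec c s u s'' \<Longrightarrow> u = t \<and> s'' = s'"
proof (induction arbitrary: u s'' rule: exec.induct)
  case Skip
  then show ?case by (auto elim: exec.cases)
next
  case Write
  from Write.prems show ?case by cases auto
next
  case Seq
  from Seq.prems show ?case by cases (use Seq.IH in blast)
next
  case CondTrue
  from CondTrue.prems show ?case by cases (use CondTrue.IH CondTrue.hyps in blast)+
next
  case CondFalse
  from CondFalse.prems show ?case by cases (use CondFalse.IH CondFalse.hyps in blast)+
next
  case WhileFalse
  from WhileFalse.prems show ?case by cases (use WhileFalse.hyps in auto)
next
  case WhileTrue
  from WhileTrue.prems show ?case by cases (use WhileTrue.IH WhileTrue.hyps in blast)+
qed

text \<open>
  A graph with vertex set \<open>{..<n}\<close> is given by \<open>n\<close> and its row-major adjacency matrix; all other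
  memory is initially 0.
\<close>

definition input_state :: "nat \<Rightarrow> nat graph \<Rightarrow> state" where
  "input_state n G = (\<lambda>x k.
     if x = ''n'' \<and> k = 0 then int n
     else if x = ''A'' \<and> (\<exists>i<n. \<exists>j<n. k = int (n * i + j) \<and> {i, j} \<in> edges G) then 1
     else 0)"

definition output_value :: "state \<Rightarrow> int" where
  "output_value s = s ''out'' 0"

end

theory Submission
  imports Defs "HOL-Library.Disjoint_Sets" "HOL-Computational_Algebra.Polynomial"
begin

text \<open>
  In a cograph every set of at least two vertices contains two twins \<open>u\<close>, \<open>v\<close>: vertices that no
  other vertex of the set distinguishes.  Contracting twins repeatedly until one vertex is left takes
  \<open>n - 1\<close> rounds, and a naive search for twins takes \<open>O(n\<^sup>3)\<close> steps.  Each remaining vertex \<open>u\<close>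
  stands for a module \<open>S\<close> of the original graph, for which the program stores the polynomial
  \<open>D(S) = \<Sum>\<^sub>M x\<^sup>k\<close>, where \<open>M\<close> ranges over the matchings inside \<open>S\<close> and \<open>k\<close> is the number of
  vertices of \<open>S\<close> that \<open>M\<close> leaves uncovered.  The answer is \<open>D({..<n})\<close> at \<open>0\<close>.

  When \<open>u\<close> and \<open>v\<close> are contracted, their modules are completely joined (\<open>e = 1\<close>) or not joined at all
  (\<open>e = 0\<close>), and the new polynomial is \<open>B(D(S), D(T))\<close> for the bilinear operation \<open>B\<close> with
  \<open>B(1, g) = g\<close> and \<open>B(x f, g) = x B(f, g) + e B(f, g')\<close>.  This follows by induction on \<open>S\<close> from
  \<open>D(S) = x D(S - v) + \<Sum>\<^sub>w D(S - v - w)\<close>, \<open>w\<close> ranging over the neighbours of \<open>v\<close> in \<open>S\<close>, because the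
  derivative of \<open>D(T)\<close> is \<open>\<Sum>\<^sub>w D(T - w)\<close>, \<open>w\<close> ranging over \<open>T\<close>.  The table of the coefficients of
  \<open>B(x\<^sup>a, x\<^sup>b)\<close> is filled in \<open>O(n\<^sup>3)\<close> steps by the recursion, without divisions.
\<close>

section \<open>Matching polynomials\<close>

text \<open>The matchings of the subgraph induced by \<open>S\<close>. The edge set stays fixed, so
  deleting vertices is just set difference on \<open>S\<close>.\<close>

definition matchings :: "'a set set \<Rightarrow> 'a set \<Rightarrow> 'a set set set" where
  "matchings E S = {M. M \<subseteq> E \<and> \<Union>M \<subseteq> S \<and> disjoint M}"

definition matching_poly :: "'a set set \<Rightarrow> 'a set \<Rightarrow> int poly" where
  "matching_poly E S = (\<Sum>M\<in>matchings E S. monom 1 (card (S - \<Union>M)))"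

lemma finite_matchings: "finite S \<Longrightarrow> finite (matchings E S)"
  by (rule finite_subset[of _ "Pow (Pow S)"]) (auto simp: matchings_def)

lemma matchings_empty:
  assumes "\<forall>e\<in>E. card e = 2"
  shows "matchings E {} = {{}}"
proof
  have "{} \<notin> E" using assms by (metis card.empty zero_neq_numeral)
  then show "matchings E {} \<subseteq> {{}}" by (auto simp: matchings_def subset_singleton_iff)
qed (simp add: matchings_def)

lemma matching_poly_empty:
  assumes "\<forall>e\<in>E. card e = 2"
  shows "matching_poly E {} = 1"
  using matchings_empty[OF assms] by (simp add: matching_poly_def)

lemma matchings_avoiding: "matchings E (S - {v}) = {M \<in> matchings E S. v \<notin> \<Union>M}"
  by (auto simp: matchings_def)

text \<open>A matching that covers \<open>v\<close> is determined by the partner \<open>w\<close> of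
  \<open>v\<close> and by what remains after removing \<open>{v, w}\<close>, which is a matching
  that avoids both ends.\<close>

lemma matchings_covering:
  assumes E: "\<forall>e\<in>E. card e = 2" and v: "v \<in> S"
  shows "{M \<in> matchings E S. v \<in> \<Union>M} =
    (\<Union>w\<in>{w \<in> S - {v}. {v, w} \<in> E}. insert {v, w} ` matchings E (S - {v, w}))" (is "?L = ?R")
proof (intro equalityI subsetI)
  fix M assume "M \<in> ?L"
  then have M: "M \<subseteq> E" "\<Union>M \<subseteq> S" "disjoint M" and "v \<in> \<Union>M"
    by (auto simp: matchings_def)
  then obtain e where e: "e \<in> M" "v \<in> e" by blast
  then have "card e = 2" using E M(1) by blast
  then obtain w where w: "e = {v, w}" "w \<noteq> v"
    using e(2) by (auto simp: card_2_iff insert_commute)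
  have disj: "f \<inter> {v, w} = {}" if "f \<in> M - {e}" for f
    using that M(3) e w disjointD[of M f e] by blast
  have "M - {e} \<in> matchings E (S - {v, w})"
    unfolding matchings_def
  proof (intro CollectI conjI)
    show "\<Union>(M - {e}) \<subseteq> S - {v, w}" using M(2) disj by blast
    show "disjoint (M - {e})" using M(3) by (simp add: disjoint_def)
  qed (use M in auto)
  moreover have "M = insert {v, w} (M - {e})" using e w by auto
  ultimately have "M \<in> insert {v, w} ` matchings E (S - {v, w})" by (rule rev_image_eqI)
  moreover have "w \<in> S - {v}" "{v, w} \<in> E" using e w M by auto
  ultimately show "M \<in> ?R" by blast
next
  fix M assume "M \<in> ?R"
  then obtain w N where w: "w \<in> S - {v}" "{v, w} \<in> E"
    and N: "M = insert {v, w} N" "N \<in> matchings E (S - {v, w})"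
    by blast
  then have sub: "N \<subseteq> E" "\<Union>N \<subseteq> S - {v, w}" "disjoint N" by (auto simp: matchings_def)
  moreover have "disjoint (insert {v, w} N)"
    using sub by (simp add: disjoint_def) blast
  ultimately have "M \<in> matchings E S" using w N v by (auto simp: matchings_def)
  then show "M \<in> ?L" using N by simp
qed

text \<open>Split by the status of \<open>v\<close>. If \<open>v\<close> is uncovered, it
  contributes one factor \<open>x\<close> to a matching inside \<open>S - {v}\<close>. If it is
  matched to \<open>w\<close>, removing that edge together with both ends leaves the set of
  uncovered vertices unchanged.\<close>

lemma matching_poly_rec:
  assumes E: "\<forall>e\<in>E. card e = 2" and S: "finite S" and v: "v \<in> S"
  shows "matching_poly E S =
    monom 1 1 * matching_poly E (S - {v}) + (\<Sum>w | w \<in> S - {v} \<and> {v, w} \<in> E. matching_poly E (S - {v, w}))"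
proof -
  let ?f = "\<lambda>M. monom (1::int) (card (S - \<Union>M))"
  let ?W = "{w \<in> S - {v}. {v, w} \<in> E}"
  have fin: "finite (matchings E X)" if "X \<subseteq> S" for X
    using finite_matchings finite_subset[OF that S] by blast
  have "matching_poly E S = sum ?f {M \<in> matchings E S. v \<notin> \<Union>M} + sum ?f {M \<in> matchings E S. v \<in> \<Union>M}"
    unfolding matching_poly_def using fin[of S]
    by (subst sum.union_disjoint[symmetric]) (auto intro!: sum.cong)
  moreover have "sum ?f {M \<in> matchings E S. v \<notin> \<Union>M} = monom 1 1 * matching_poly E (S - {v})"
  proof -
    have "?f M = monom 1 1 * monom 1 (card (S - {v} - \<Union>M))" if "M \<in> matchings E (S - {v})" for M
    proof -
      have "S - \<Union>M = insert v (S - {v} - \<Union>M)"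
        using that v by (auto simp: matchings_def)
      then have "card (S - \<Union>M) = Suc (card (S - {v} - \<Union>M))"
        using S by (metis DiffE card_insert_disjoint finite_Diff insertI1)
      then show ?thesis by (simp add: mult_monom)
    qed
    then show ?thesis
      unfolding matchings_avoiding[symmetric] matching_poly_def sum_distrib_left
      by (rule sum.cong[OF refl])
  qed
  moreover have "sum ?f {M \<in> matchings E S. v \<in> \<Union>M} = (\<Sum>w\<in>?W. matching_poly E (S - {v, w}))"
  proof -
    have new: "{v, w} \<notin> M" if "M \<in> matchings E (S - {v, w})" for w M
      using that by (auto simp: matchings_def)
    have "sum ?f {M \<in> matchings E S. v \<in> \<Union>M} =
        (\<Sum>w\<in>?W. sum ?f (insert {v, w} ` matchings E (S - {v, w})))"
      unfolding matchings_covering[OF E v]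
    proof (rule sum.UNION_disjoint)
      \<comment> \<open>A matching counted for two partners of \<open>v\<close> would contain two
        distinct edges at \<open>v\<close>.\<close>
      show "\<forall>i\<in>?W. \<forall>j\<in>?W. i \<noteq> j \<longrightarrow>
          insert {v, i} ` matchings E (S - {v, i}) \<inter> insert {v, j} ` matchings E (S - {v, j}) = {}"
      proof (intro ballI impI equals0I)
        fix i j M assume ij: "i \<in> ?W" "j \<in> ?W" "i \<noteq> j"
          and M: "M \<in> insert {v, i} ` matchings E (S - {v, i}) \<inter> insert {v, j} ` matchings E (S - {v, j})"
        then have "{v, i} \<in> M" "{v, j} \<in> M" "M \<in> {M \<in> matchings E S. v \<in> \<Union>M}"
          unfolding matchings_covering[OF E v] by auto
        then have "{v, i} = {v, j}"
          using disjointD[of M "{v, i}" "{v, j}"] by (auto simp: matchings_def)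
        then show False using ij by (auto simp: doubleton_eq_iff)
      qed
    qed (use S fin in auto)
    also have "\<dots> = (\<Sum>w\<in>?W. matching_poly E (S - {v, w}))"
    proof (rule sum.cong)
      fix w assume "w \<in> ?W"
      have "inj_on (insert {v, w}) (matchings E (S - {v, w}))"
        using new[of _ w] by (auto intro!: inj_onI simp: insert_ident)
      moreover have "S - \<Union>(insert {v, w} M) = S - {v, w} - \<Union>M" for M by auto
      ultimately show "sum ?f (insert {v, w} ` matchings E (S - {v, w})) = matching_poly E (S - {v, w})"
        by (simp add: sum.reindex matching_poly_def)
    qed simp
    finally show ?thesis .
  qed
  ultimately show ?thesis by simp
qed

lemma smult_sum_right: "smult c (\<Sum>x\<in>X. p x) = (\<Sum>x\<in>X. smult c (p x))"
  by (induction X rule: infinite_finite_induct) (auto simp: smult_add_right)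

lemma monom_1_mult: "monom 1 1 * p = pCons 0 p"
  for p :: "'a::comm_semiring_1 poly"
  by (simp add: monom_Suc monom_0)

text \<open>Double counting of pairs of a matching and a vertex \<open>w\<close> it leaves
  uncovered: the derivative of \<open>x^k\<close> is one \<open>x^(k-1)\<close> for each of the
  \<open>k\<close> uncovered vertices, and the matchings that leave \<open>w\<close> uncovered are
  those inside \<open>S - {w}\<close>.\<close>

lemma pderiv_matching_poly:
  assumes S: "finite S"
  shows "pderiv (matching_poly E S) = (\<Sum>w\<in>S. matching_poly E (S - {w}))"
proof -
  \<comment> \<open>The truncated subtraction is harmless: if no vertex is uncovered, the inner sum
    over \<open>w\<close> is empty.\<close>
  let ?m = "\<lambda>M. monom (1::int) (card (S - \<Union>M) - 1)"
  have "pderiv (matching_poly E S) = (\<Sum>M\<in>matchings E S. \<Sum>w\<in>S - \<Union>M. ?m M)"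
    unfolding matching_poly_def higher_pderiv_sum[of 1, simplified]
    by (intro sum.cong) (auto simp: pderiv_monom smult_monom of_nat_monom mult_monom)
  also have "\<dots> = (\<Sum>M\<in>matchings E S. \<Sum>w | w \<in> S \<and> w \<notin> \<Union>M. ?m M)"
    by (intro sum.cong) auto
  also have "\<dots> = (\<Sum>w\<in>S. \<Sum>M | M \<in> matchings E S \<and> w \<notin> \<Union>M. ?m M)"
    using S by (intro sum.swap_restrict finite_matchings)
  also have "\<dots> = (\<Sum>w\<in>S. matching_poly E (S - {w}))"
  proof (rule sum.cong)
    fix w assume w: "w \<in> S"
    have "?m M = monom 1 (card (S - {w} - \<Union>M))" if "M \<in> matchings E (S - {w})" for M
    proof -
      have "S - {w} - \<Union>M = (S - \<Union>M) - {w}" "w \<in> S - \<Union>M"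
        using that w by (auto simp: matchings_def)
      then show ?thesis by (simp add: card_Diff_singleton)
    qed
    then show "(\<Sum>M | M \<in> matchings E S \<and> w \<notin> \<Union>M. ?m M) = matching_poly E (S - {w})"
      unfolding matchings_avoiding[symmetric] matching_poly_def by (rule sum.cong[OF refl])
  qed simp
  finally show ?thesis .
qed

lemma degree_matching_poly:
  assumes "finite S"
  shows "degree (matching_poly E S) \<le> card S"
  unfolding matching_poly_def
proof (rule degree_sum_le[OF finite_matchings[OF assms]])
  fix M
  have "card (S - \<Union>M) \<le> card S" using assms by (simp add: card_mono)
  then show "degree (monom (1::int) (card (S - \<Union>M))) \<le> card S"
    by (meson degree_monom_le le_trans)
qed

section \<open>The bilinear operation that combines two matching polynomials\<close>

text \<open>This is \<open>B(x^a, g)\<close>, in closed form the sum over \<open>k\<close> of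
  \<open>binom(a, k) e^k x^(a-k)\<close> times the \<open>k\<close>-th derivative of
  \<open>g\<close>. The derivatives act on \<open>g\<close> alone, never on the factors
  \<open>x\<close>. For \<open>e = 1\<close>, \<open>k\<close> is the number of edges placed between
  the two sides.\<close>

primrec merge_monom :: "int \<Rightarrow> nat \<Rightarrow> int poly \<Rightarrow> int poly" where
  "merge_monom e 0 g = g"
| "merge_monom e (Suc a) g = monom 1 1 * merge_monom e a g + smult e (merge_monom e a (pderiv g))"

definition merge :: "int \<Rightarrow> int poly \<Rightarrow> int poly \<Rightarrow> int poly" where
  "merge e f g = (\<Sum>a\<le>degree f. smult (coeff f a) (merge_monom e a g))"

lemma merge_monom_0 [simp]: "merge_monom e a 0 = 0"
  by (induction a) auto

lemma merge_monom_add: "merge_monom e a (g + h) = merge_monom e a g + merge_monom e a h"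
  by (induction a arbitrary: g h) (auto simp: algebra_simps pderiv_add smult_add_right)

lemma merge_monom_smult: "merge_monom e a (smult k g) = smult k (merge_monom e a g)"
  by (induction a arbitrary: g) (auto simp: algebra_simps pderiv_smult smult_add_right)

lemma merge_monom_sum: "merge_monom e a (\<Sum>x\<in>X. g x) = (\<Sum>x\<in>X. merge_monom e a (g x))"
  by (induction X rule: infinite_finite_induct) (auto simp: merge_monom_add)

lemma merge_eq:
  assumes "degree f \<le> N"
  shows "merge e f g = (\<Sum>a\<le>N. smult (coeff f a) (merge_monom e a g))"
  unfolding merge_def using assms by (intro sum.mono_neutral_left) (auto simp: coeff_eq_0)

lemma merge_0_left [simp]: "merge e 0 g = 0"
  by (simp add: merge_def)

lemma merge_1_left [simp]: "merge e 1 g = g"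
  by (simp add: merge_def)

lemma merge_add_left: "merge e (f + f') g = merge e f g + merge e f' g"
proof -
  let ?N = "max (degree f) (degree f')"
  have "degree (f + f') \<le> ?N" by (rule degree_add_le_max)
  then show ?thesis
    using merge_eq[of f ?N] merge_eq[of f' ?N] merge_eq[of "f + f'" ?N]
    by (simp add: sum.distrib smult_add_left)
qed

lemma merge_sum_left: "merge e (\<Sum>x\<in>X. f x) g = (\<Sum>x\<in>X. merge e (f x) g)"
  by (induction X rule: infinite_finite_induct) (auto simp: merge_add_left)

lemma merge_sum_right: "merge e f (\<Sum>x\<in>X. g x) = (\<Sum>x\<in>X. merge e f (g x))"
proof -
  have "merge e f (\<Sum>x\<in>X. g x) = (\<Sum>a\<le>degree f. \<Sum>x\<in>X. smult (coeff f a) (merge_monom e a (g x)))"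
    by (simp add: merge_def merge_monom_sum smult_sum_right)
  also have "\<dots> = (\<Sum>x\<in>X. merge e f (g x))"
    unfolding merge_def by (rule sum.swap)
  finally show ?thesis .
qed

text \<open>The recursion for monomials carries over to all \<open>f\<close> by linearity; the shift
  of the index loses no term because the constant coefficient of \<open>pCons 0 f\<close> is
  0.\<close>

lemma merge_shift_left:
  "merge e (monom 1 1 * f) g = monom 1 1 * merge e f g + smult e (merge e f (pderiv g))"
proof -
  have "degree (pCons 0 f) \<le> Suc (degree f)" by (simp add: degree_pCons_le)
  then have "merge e (pCons 0 f) g = (\<Sum>a\<le>Suc (degree f). smult (coeff (pCons 0 f) a) (merge_monom e a g))"
    by (rule merge_eq)
  also have "\<dots> = (\<Sum>a\<le>degree f. smult (coeff f a) (merge_monom e (Suc a) g))"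
    by (subst sum.atMost_Suc_shift) simp
  also have "\<dots> = monom 1 1 * merge e f g + smult e (merge e f (pderiv g))"
    by (simp add: merge_def smult_add_right sum.distrib sum_distrib_left smult_sum_right mult.commute)
  finally show ?thesis by (simp only: monom_1_mult)
qed

text \<open>Both \<open>S \<union> T\<close> and \<open>S\<close> are expanded at a vertex
  \<open>v\<close> of \<open>S\<close>. The neighbours of \<open>v\<close> in \<open>S\<close> give
  the same terms on both sides; its neighbours in \<open>T\<close> are all of \<open>T\<close> or
  none, according to \<open>b\<close>.\<close>

lemma matching_poly_Un:
  fixes S T :: "'a set"
  assumes E: "\<forall>e\<in>E. card e = 2" and "finite S" "finite T" "S \<inter> T = {}"
    and "\<And>x y. x \<in> S \<Longrightarrow> y \<in> T \<Longrightarrow> {x, y} \<in> E \<longleftrightarrow> b"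
  shows "matching_poly E (S \<union> T) = merge (of_bool b) (matching_poly E S) (matching_poly E T)"
  using assms(2-)
proof (induction "card S" arbitrary: S T rule: less_induct)
  case less
  let ?D = "matching_poly E"
  show ?case
  proof (cases "S = {}")
    case True
    then show ?thesis by (simp add: matching_poly_empty[OF E])
  next
    case False
    then obtain v where v: "v \<in> S" by blast
    \<comment> \<open>\<open>T\<close> has to be allowed to shrink as well, since a partner of
      \<open>v\<close> may lie in \<open>T\<close>.\<close>
    have IH: "?D (S' \<union> T') = merge (of_bool b) (?D S') (?D T')"
      if "S' \<subseteq> S - {v}" "T' \<subseteq> T" for S' T'
    proof (rule less.hyps)
      show "card S' < card S"
        using that v less.prems by (intro psubset_card_mono) auto
      show "{x, y} \<in> E \<longleftrightarrow> b" if "x \<in> S'" "y \<in> T'" for x y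
        using less.prems(4)[of x y] that \<open>S' \<subseteq> S - {v}\<close> \<open>T' \<subseteq> T\<close> by blast
    qed (use that less.prems in \<open>auto intro: finite_subset\<close>)
    let ?W = "{w. w \<in> S - {v} \<and> {v, w} \<in> E}"
    have W: "{w. w \<in> S \<union> T - {v} \<and> {v, w} \<in> E} = ?W \<union> (if b then T else {})"
      using v less.prems by auto
    have "?D (S \<union> T) = monom 1 1 * ?D (S \<union> T - {v}) +
        (\<Sum>w | w \<in> S \<union> T - {v} \<and> {v, w} \<in> E. ?D (S \<union> T - {v, w}))"
      using v less.prems by (intro matching_poly_rec[OF E]) auto
    also have "(\<Sum>w | w \<in> S \<union> T - {v} \<and> {v, w} \<in> E. ?D (S \<union> T - {v, w})) =
        (\<Sum>w\<in>?W. ?D (S \<union> T - {v, w})) + (\<Sum>w\<in>(if b then T else {}). ?D (S \<union> T - {v, w}))"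
      unfolding W using less.prems by (intro sum.union_disjoint) auto
    also have "S \<union> T - {v} = (S - {v}) \<union> T"
      using v less.prems(3) by auto
    also have "?D \<dots> = merge (of_bool b) (?D (S - {v})) (?D T)"
      by (intro IH) auto
    also have "(\<Sum>w\<in>?W. ?D (S \<union> T - {v, w})) = (\<Sum>w\<in>?W. merge (of_bool b) (?D (S - {v, w})) (?D T))"
    proof (rule sum.cong)
      fix w assume "w \<in> ?W"
      then have eq: "S \<union> T - {v, w} = (S - {v, w}) \<union> T" using v less.prems(3) by auto
      show "?D (S \<union> T - {v, w}) = merge (of_bool b) (?D (S - {v, w})) (?D T)"
        unfolding eq by (rule IH) auto
    qed simp
    also have "\<dots> = merge (of_bool b) (\<Sum>w\<in>?W. ?D (S - {v, w})) (?D T)"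
      by (rule merge_sum_left[symmetric])
    also have "(\<Sum>w\<in>(if b then T else {}). ?D (S \<union> T - {v, w})) =
        smult (of_bool b) (\<Sum>w\<in>T. merge (of_bool b) (?D (S - {v})) (?D (T - {w})))"
    proof -
      have "?D (S \<union> T - {v, w}) = merge (of_bool b) (?D (S - {v})) (?D (T - {w}))" if "w \<in> T" for w
      proof -
        have eq: "S \<union> T - {v, w} = (S - {v}) \<union> (T - {w})" using that v less.prems(3) by auto
        show ?thesis unfolding eq by (rule IH) auto
      qed
      then show ?thesis by simp
    qed
    \<comment> \<open>Summing over all partners in \<open>T\<close> produces the derivative, which
      is the second term of \<open>merge_shift_left\<close>.\<close>
    also have "\<dots> = smult (of_bool b) (merge (of_bool b) (?D (S - {v})) (pderiv (?D T)))"
      by (simp only: merge_sum_right pderiv_matching_poly[OF \<open>finite T\<close>])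
    finally have "?D (S \<union> T) = merge (of_bool b) (monom 1 1 * ?D (S - {v}) + (\<Sum>w\<in>?W. ?D (S - {v, w}))) (?D T)"
      by (simp only: merge_add_left merge_shift_left ac_simps)
    then show ?thesis
      using matching_poly_rec[OF E \<open>finite S\<close> v] by simp
  qed
qed

definition merge_coeff :: "int \<Rightarrow> nat \<Rightarrow> nat \<Rightarrow> nat \<Rightarrow> int" where
  "merge_coeff e a b c = coeff (merge_monom e a (monom 1 b)) c"

lemma merge_coeff_0: "merge_coeff e 0 b c = of_bool (b = c)"
  by (simp add: merge_coeff_def)

text \<open>Coefficientwise form of the recursion, using that \<open>x^b\<close> has derivative
  \<open>b x^(b-1)\<close>. At \<open>b = 0\<close> the truncated \<open>b - 1\<close> is cancelled
  by the factor \<open>int b\<close>.\<close>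

lemma merge_coeff_Suc:
  "merge_coeff e (Suc a) b c =
    e * int b * merge_coeff e a (b - 1) c + (if c = 0 then 0 else merge_coeff e a b (c - 1))"
proof -
  have "pderiv (monom (1::int) b) = smult (int b) (monom 1 (b - 1))"
    by (simp add: pderiv_monom smult_monom)
  then show ?thesis
    unfolding merge_coeff_def merge_monom.simps monom_1_mult
    by (simp add: merge_monom_smult coeff_pCons split: nat.split)
qed

lemma coeff_merge:
  assumes "degree f \<le> N" "degree g \<le> N"
  shows "coeff (merge e f g) c = (\<Sum>a\<le>N. \<Sum>b\<le>N. coeff f a * coeff g b * merge_coeff e a b c)"
proof -
  have "g = (\<Sum>b\<le>N. smult (coeff g b) (monom 1 b))"
    using poly_as_sum_of_monoms'[OF assms(2)] by (simp add: smult_monom)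
  then have "merge_monom e a g = (\<Sum>b\<le>N. smult (coeff g b) (merge_monom e a (monom 1 b)))" for a
    by (metis (no_types, lifting) merge_monom_smult merge_monom_sum sum.cong)
  then show ?thesis
    by (simp add: merge_eq[OF assms(1)] coeff_sum sum_distrib_left merge_coeff_def mult.assoc)
qed

section \<open>Twins in cographs\<close>

lemma cograph_wf:
  assumes "cograph G"
  shows "finite (verts G) \<and> verts G \<noteq> {} \<and> (\<forall>e\<in>edges G. e \<subseteq> verts G \<and> card e = 2)"
  using assms
proof (induction rule: cograph.induct)
  case (join G H)
  then have "card {v, w} = 2" if "v \<in> verts G" "w \<in> verts H" for v w
    using that by (auto simp: card_insert_if)
  then show ?case using join.IH by (auto simp: complete_join_def)
qed (auto simp: disjoint_union_def)

text \<open>Only the vertices of \<open>X\<close> count as witnesses, and \<open>u\<close>,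
  \<open>v\<close> may be adjacent or not. The case \<open>u = v\<close> is allowed here, so
  distinctness is demanded separately.\<close>

definition twins :: "'a set set \<Rightarrow> 'a set \<Rightarrow> 'a \<Rightarrow> 'a \<Rightarrow> bool" where
  "twins E X u v \<longleftrightarrow> u \<in> X \<and> v \<in> X \<and> (\<forall>w\<in>X - {u, v}. {u, w} \<in> E \<longleftrightarrow> {v, w} \<in> E)"

lemma twins_commute: "twins E X u v \<longleftrightarrow> twins E X v u"
  by (auto simp: twins_def)

text \<open>Twins inside one part stay twins in \<open>X\<close>, because a vertex of the other part
  is adjacent to both or to neither. If no part contains two vertices of \<open>X\<close>, then
  \<open>X\<close> is a pair, whose members are trivially twins. The flag \<open>b\<close> covers
  union and join at once.\<close>

lemma twins_of_parts:
  assumes "X \<subseteq> V \<union> W" "V \<inter> W = {}" "finite X" "1 < card X"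
    and V: "1 < card (X \<inter> V) \<Longrightarrow> \<exists>u v. u \<noteq> v \<and> twins EV (X \<inter> V) u v"
    and W: "1 < card (X \<inter> W) \<Longrightarrow> \<exists>u v. u \<noteq> v \<and> twins EW (X \<inter> W) u v"
    and EV: "\<And>x y. x \<in> V \<Longrightarrow> y \<in> V \<Longrightarrow> {x, y} \<in> E \<longleftrightarrow> {x, y} \<in> EV"
    and EW: "\<And>x y. x \<in> W \<Longrightarrow> y \<in> W \<Longrightarrow> {x, y} \<in> E \<longleftrightarrow> {x, y} \<in> EW"
    and cross: "\<And>x y. x \<in> V \<Longrightarrow> y \<in> W \<Longrightarrow> {x, y} \<in> E \<longleftrightarrow> b"
  shows "\<exists>u v. u \<noteq> v \<and> twins E X u v"
proof -
  have cross': "{y, x} \<in> E \<longleftrightarrow> b" if "x \<in> V" "y \<in> W" for x y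
    using cross[OF that] by (simp add: insert_commute)
  consider "1 < card (X \<inter> V)" | "1 < card (X \<inter> W)" | "card (X \<inter> V) \<le> 1" "card (X \<inter> W) \<le> 1"
    by linarith
  then show ?thesis
  proof cases
    case 1
    then obtain u v where uv: "u \<noteq> v" "twins EV (X \<inter> V) u v" using V by blast
    have "{u, w} \<in> E \<longleftrightarrow> {v, w} \<in> E" if "w \<in> X - {u, v}" for w
    proof (cases "w \<in> V")
      case True
      then show ?thesis using that uv EV[of u w] EV[of v w] by (auto simp: twins_def)
    next
      case False
      then have "w \<in> W" using that assms(1) by blast
      then show ?thesis using uv cross[of u w] cross[of v w] by (simp add: twins_def)
    qed
    then have "twins E X u v" using uv by (simp add: twins_def)
    then show ?thesis using uv by blast
  next
    case 2
    then obtain u v where uv: "u \<noteq> v" "twins EW (X \<inter> W) u v" using W by blast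
    have "{u, w} \<in> E \<longleftrightarrow> {v, w} \<in> E" if "w \<in> X - {u, v}" for w
    proof (cases "w \<in> W")
      case True
      then show ?thesis using that uv EW[of u w] EW[of v w] by (auto simp: twins_def)
    next
      case False
      then have "w \<in> V" using that assms(1) by blast
      then show ?thesis using uv cross'[of w u] cross'[of w v] by (simp add: twins_def)
    qed
    then have "twins E X u v" using uv by (simp add: twins_def)
    then show ?thesis using uv by blast
  next
    case 3
    have "X = (X \<inter> V) \<union> (X \<inter> W)" using assms(1) by blast
    moreover have "card ((X \<inter> V) \<union> (X \<inter> W)) = card (X \<inter> V) + card (X \<inter> W)"
      using assms(2,3) by (intro card_Un_disjoint) auto
    ultimately have "card X = card (X \<inter> V) + card (X \<inter> W)" by simp
    then have "card X = 2" using 3 assms(4) by linarith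
    then obtain u v where "u \<noteq> v" "X = {u, v}" by (auto simp: card_2_iff)
    then show ?thesis by (auto simp: twins_def)
  qed
qed

text \<open>Arbitrary \<open>X\<close> is needed twice: the induction passes to the intersections of
  \<open>X\<close> with the two parts, and the algorithm applies the result to the set of remaining
  vertices.\<close>

lemma cograph_has_twins:
  assumes "cograph G" "X \<subseteq> verts G" "1 < card X"
  shows "\<exists>u v. u \<noteq> v \<and> twins (edges G) X u v"
  using assms
proof (induction arbitrary: X rule: cograph.induct)
  case (single v)
  then have "card X \<le> card {v}" by (intro card_mono) auto
  then show ?case using single by simp
next
  case (union G H)
  have wf: "finite (verts G)" "finite (verts H)"
    "\<And>x y. {x, y} \<in> edges G \<Longrightarrow> x \<in> verts G \<and> y \<in> verts G"
    "\<And>x y. {x, y} \<in> edges H \<Longrightarrow> x \<in> verts H \<and> y \<in> verts H"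
    using cograph_wf[OF union.hyps(1)] cograph_wf[OF union.hyps(2)] by (auto dest!: bspec)
  show ?case
  proof (rule twins_of_parts[where b = False])
    show X: "X \<subseteq> verts G \<union> verts H" using union.prems by (simp add: disjoint_union_def)
    show "finite X" using X wf(1,2) by (simp add: finite_subset)
    show "{x, y} \<in> edges (disjoint_union G H) \<longleftrightarrow> {x, y} \<in> edges G"
      if "x \<in> verts G" "y \<in> verts G" for x y
      using that wf(4)[of x y] union.hyps(3) by (auto simp: disjoint_union_def)
    show "{x, y} \<in> edges (disjoint_union G H) \<longleftrightarrow> {x, y} \<in> edges H"
      if "x \<in> verts H" "y \<in> verts H" for x y
      using that wf(3)[of x y] union.hyps(3) by (auto simp: disjoint_union_def)
    show "{x, y} \<in> edges (disjoint_union G H) \<longleftrightarrow> False"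
      if "x \<in> verts G" "y \<in> verts H" for x y
      using that wf(3,4)[of x y] union.hyps(3) by (auto simp: disjoint_union_def)
    show "1 < card X" by (rule union.prems)
  qed (simp_all add: union)
next
  case (join G H)
  have wf: "finite (verts G)" "finite (verts H)"
    "\<And>x y. {x, y} \<in> edges G \<Longrightarrow> x \<in> verts G \<and> y \<in> verts G"
    "\<And>x y. {x, y} \<in> edges H \<Longrightarrow> x \<in> verts H \<and> y \<in> verts H"
    using cograph_wf[OF join.hyps(1)] cograph_wf[OF join.hyps(2)] by (auto dest!: bspec)
  have edge: "{x, y} \<in> edges (complete_join G H) \<longleftrightarrow> {x, y} \<in> edges G \<or> {x, y} \<in> edges H \<or>
      x \<in> verts G \<and> y \<in> verts H \<or> y \<in> verts G \<and> x \<in> verts H" for x y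
    by (auto simp: complete_join_def doubleton_eq_iff)
  show ?case
  proof (rule twins_of_parts[where b = True])
    show X: "X \<subseteq> verts G \<union> verts H" using join.prems by (simp add: complete_join_def)
    show "finite X" using X wf(1,2) by (simp add: finite_subset)
    show "{x, y} \<in> edges (complete_join G H) \<longleftrightarrow> {x, y} \<in> edges G"
      if "x \<in> verts G" "y \<in> verts G" for x y
      using that wf(4)[of x y] join.hyps(3) unfolding edge by blast
    show "{x, y} \<in> edges (complete_join G H) \<longleftrightarrow> {x, y} \<in> edges H"
      if "x \<in> verts H" "y \<in> verts H" for x y
      using that wf(3)[of x y] join.hyps(3) unfolding edge by blast
    show "{x, y} \<in> edges (complete_join G H) \<longleftrightarrow> True"
      if "x \<in> verts G" "y \<in> verts H" for x y
      using that unfolding edge by blast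
    show "1 < card X" by (rule join.prems)
  qed (simp_all add: join)
qed

section \<open>Perfect matchings as a constant coefficient\<close>

text \<open>Perfect matchings are the matchings that leave no vertex uncovered, hence those
  contributing \<open>x^0\<close>. As edges consist of vertices of \<open>G\<close>, the uniqueness
  of the covering edge makes the edges disjoint.\<close>

lemma num_perfect_matchings_eq:
  assumes fin: "finite (verts G)" and E: "\<forall>e\<in>edges G. e \<subseteq> verts G"
  shows "int (num_perfect_matchings G) = coeff (matching_poly (edges G) (verts G)) 0"
proof -
  let ?M = "matchings (edges G) (verts G)"
  have "perfect_matching G M \<longleftrightarrow> M \<in> ?M \<and> verts G \<subseteq> \<Union>M" for M
  proof
    assume M: "perfect_matching G M"
    then have ME: "M \<subseteq> edges G" and cov: "\<And>v. v \<in> verts G \<Longrightarrow> \<exists>!e. e \<in> M \<and> v \<in> e"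
      by (auto simp: perfect_matching_def)
    have sub: "\<Union>M \<subseteq> verts G" using ME E by blast
    have "disjoint M"
    proof (rule disjointI, rule equals0I)
      fix e f v assume "e \<in> M" "f \<in> M" "e \<noteq> f" "v \<in> e \<inter> f"
      then show False using cov[of v] sub by auto
    qed
    moreover have "verts G \<subseteq> \<Union>M" using cov by blast
    ultimately show "M \<in> ?M \<and> verts G \<subseteq> \<Union>M"
      using ME sub by (simp add: matchings_def)
  next
    assume M: "M \<in> ?M \<and> verts G \<subseteq> \<Union>M"
    have "\<exists>!e. e \<in> M \<and> v \<in> e" if "v \<in> verts G" for v
    proof -
      have "v \<in> \<Union>M" using M that by blast
      then obtain e where e: "e \<in> M" "v \<in> e" by blast
      moreover have "f = e" if "f \<in> M" "v \<in> f" for f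
        using M e that disjointD[of M e f] by (auto simp: matchings_def)
      ultimately show ?thesis by blast
    qed
    then show "perfect_matching G M"
      using M by (simp add: perfect_matching_def matchings_def)
  qed
  moreover have "card (verts G - \<Union>M) = 0 \<longleftrightarrow> verts G \<subseteq> \<Union>M" for M
    using fin by auto
  ultimately have "num_perfect_matchings G = card {M \<in> ?M. card (verts G - \<Union>M) = 0}"
    by (simp add: num_perfect_matchings_def)
  also have "int \<dots> = (\<Sum>M\<in>?M. if card (verts G - \<Union>M) = 0 then 1 else 0)"
    using finite_matchings[OF fin] by (simp add: sum.If_cases Int_def)
  also have "\<dots> = coeff (matching_poly (edges G) (verts G)) 0"
    by (simp only: matching_poly_def coeff_sum coeff_monom)
  finally show ?thesis .
qed

section \<open>Programs with bounded loops\<close>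

text \<open>
  Each loop runs its variable through \<open>0, \<dots>, n\<close>, both ends included: these are the possible exponents,
  and as a vertex the spurious value \<open>n\<close> is never marked as present.  So the nesting depth of the loops is the
  exponent of the running time.
\<close>

datatype prog =
    Assign vname aexp aexp
  | Then prog prog  (infixr ";;" 60)
  | Branch bexp prog prog
  | Pass
  | Loop vname prog

abbreviation var :: "vname \<Rightarrow> aexp" where
  "var x \<equiv> Read x (Const 0)"

abbreviation setv :: "vname \<Rightarrow> int \<Rightarrow> state \<Rightarrow> state" where
  "setv x k s \<equiv> s(x := (s x)(0 := k))"

primrec compile :: "prog \<Rightarrow> com" where
  "compile (Assign x a b) = Write x a b"
| "compile (p ;; q) = Seq (compile p) (compile q)"
| "compile (Branch b p q) = Cond b (compile p) (compile q)"
| "compile Pass = Skip"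
| "compile (Loop i p) =
    Seq (Write i (Const 0) (Const 0))
      (While (Less (var i) (Add (var ''n'') (Const 1)))
        (Seq (compile p) (Write i (Const 0) (Add (var i) (Const 1)))))"

text \<open>A loop is a fold over a fixed list, so this semantics is total and ignores running time.
  The counter ends at \<open>n + 1\<close>, as it does in the compiled while loop.\<close>

primrec sem :: "nat \<Rightarrow> prog \<Rightarrow> state \<Rightarrow> state" where
  "sem n (Assign x a b) s = s(x := (s x)(aval a s := aval b s))"
| "sem n (p ;; q) s = sem n q (sem n p s)"
| "sem n (Branch b p q) s = (if bval b s then sem n p s else sem n q s)"
| "sem n Pass s = s"
| "sem n (Loop i p) s =
    setv i (int (Suc n)) (fold (\<lambda>k s. sem n p (setv i (int k) s)) [0..<Suc n] s)"

text \<open>An upper bound that charges both branches. For a loop, 11 is 3 for the initial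
  assignment and 8 for the failing last test; 14 is 8 for a test and 6 for the increment.\<close>

primrec cost :: "nat \<Rightarrow> prog \<Rightarrow> nat" where
  "cost n (Assign x a b) = 1 + acost a + acost b"
| "cost n (p ;; q) = cost n p + cost n q"
| "cost n (Branch b p q) = 1 + bcost b + cost n p + cost n q"
| "cost n Pass = 1"
| "cost n (Loop i p) = 11 + Suc n * (cost n p + 14)"

primrec mods :: "prog \<Rightarrow> vname set" where
  "mods (Assign x a b) = {x}"
| "mods (p ;; q) = mods p \<union> mods q"
| "mods (Branch b p q) = mods p \<union> mods q"
| "mods Pass = {}"
| "mods (Loop i p) = insert i (mods p)"

primrec wf_prog :: "prog \<Rightarrow> bool" where
  "wf_prog (Assign x a b) \<longleftrightarrow> x \<noteq> ''n''"
| "wf_prog (p ;; q) \<longleftrightarrow> wf_prog p \<and> wf_prog q"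
| "wf_prog (Branch b p q) \<longleftrightarrow> wf_prog p \<and> wf_prog q"
| "wf_prog Pass \<longleftrightarrow> True"
| "wf_prog (Loop i p) \<longleftrightarrow> i \<noteq> ''n'' \<and> i \<notin> mods p \<and> wf_prog p"

lemma sem_frame: "x \<notin> mods p \<Longrightarrow> sem n p s x = s x"
proof (induction p arbitrary: s)
  case (Loop i p)
  have "fold (\<lambda>k s. sem n p (setv i (int k) s)) ks s x = s x" for ks
    using Loop by (induction ks arbitrary: s) auto
  then show ?case using Loop by auto
qed auto

lemma wf_prog_n: "wf_prog p \<Longrightarrow> ''n'' \<notin> mods p"
  by (induction p) auto

text \<open>The compiled loop agrees with the fold because a well-formed body changes neither the
  bound \<open>''n''\<close> nor its own counter.\<close>

lemma exec_compile:
  assumes "wf_prog p" "s ''n'' 0 = int n"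
  shows "\<exists>t\<le>cost n p. exec (compile p) s t (sem n p s)"
  using assms
proof (induction p arbitrary: s)
  case (Assign x a b)
  show ?case
    unfolding cost.simps compile.simps sem.simps by (intro exI conjI, rule le_refl, rule exec.Write)
next
  case (Then p q)
  have "sem n p s ''n'' 0 = int n"
    using Then.prems sem_frame wf_prog_n by fastforce
  then obtain t u where "t \<le> cost n p" "exec (compile p) s t (sem n p s)"
    "u \<le> cost n q" "exec (compile q) (sem n p s) u (sem n q (sem n p s))"
    using Then by fastforce
  then show ?case
    by (intro exI[of _ "t + u"]) (auto intro: exec.Seq)
next
  case (Branch b p q)
  then obtain t u where "t \<le> cost n p" "exec (compile p) s t (sem n p s)"
    "u \<le> cost n q" "exec (compile q) s u (sem n q s)" by fastforce
  then show ?case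
    by (intro exI[of _ "1 + bcost b + (if bval b s then t else u)"])
      (use exec.CondTrue[of b s] exec.CondFalse[of b s] in auto)
next
  case Pass
  show ?case using exec.Skip by fastforce
next
  case (Loop i p)
  let ?b = "Less (var i) (Add (var ''n'') (Const 1))"
  let ?c = "Seq (compile p) (Write i (Const 0) (Add (var i) (Const 1)))"
  \<comment> \<open>\<open>F k\<close> performs the rounds that remain when the counter stands at
    \<open>k\<close>.\<close>
  define F where "F k = fold (\<lambda>k s. sem n p (setv i (int k) s)) [k..<Suc n]" for k
  have F_end: "F (Suc n) s = s" for s
    by (simp add: F_def)
  have F_step: "F k s = F (Suc k) (sem n p (setv i (int k) s))" if "k \<le> n" for k s
    using that unfolding F_def by (subst upt_conv_Cons) auto
  \<comment> \<open>The value left in the counter is overwritten by the next round or, after the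
    last one, by the outer assignment. This absorbs the increment that the while loop makes after
    its body.\<close>
  have F_setv: "setv i m (F k (setv i j s)) = setv i m (F k s)" if "k \<le> Suc n" for k m j s
  proof (cases "k = Suc n")
    case True
    then show ?thesis by (simp add: F_end)
  next
    case False
    then have "F k (setv i j s) = F k s" using that by (simp add: F_step[of k])
    then show ?thesis by simp
  qed
  have i: "i \<noteq> ''n''" "i \<notin> mods p" "wf_prog p" using Loop.prems by auto
  have loop: "\<exists>t\<le>8 + (Suc n - k) * (cost n p + 14).
      exec (While ?b ?c) s t (setv i (int (Suc n)) (F k s))"
    if "k \<le> Suc n" "s i 0 = int k" "s ''n'' 0 = int n" for k s
    using that
  proof (induction k arbitrary: s rule: inc_induct)
    case base
    then have "\<not> bval ?b s" by simp
    from exec.WhileFalse[OF this, of ?c] show ?case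
      using base by (intro exI[of _ "1 + bcost ?b"]) (auto simp: F_end fun_upd_idem)
  next
    case (step k)
    define s1 where "s1 = sem n p s"
    define s2 where "s2 = setv i (int (Suc k)) s1"
    have s1: "s1 i = s i" "s1 ''n'' = s ''n''"
      using i wf_prog_n sem_frame by (auto simp: s1_def)
    obtain t where t: "t \<le> cost n p" "exec (compile p) s t s1"
      using Loop.IH[OF i(3)] step.prems by (auto simp: s1_def)
    have "exec (Write i (Const 0) (Add (var i) (Const 1))) s1 6 s2"
      using exec.Write[of i "Const 0" "Add (var i) (Const 1)" s1] s1 step.prems
      by (simp add: s2_def add.commute eval_nat_numeral)
    from exec.Seq[OF t(2) this] have c: "exec ?c s (t + 6) s2" .
    have "s2 i 0 = int (Suc k)" "s2 ''n'' 0 = int n"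
      using s1 step.prems i by (simp_all add: s2_def)
    then obtain u where u: "u \<le> 8 + (Suc n - Suc k) * (cost n p + 14)"
      "exec (While ?b ?c) s2 u (setv i (int (Suc n)) (F (Suc k) s2))"
      using step.IH by blast
    have "setv i (int (Suc n)) (F (Suc k) s2) = setv i (int (Suc n)) (F (Suc k) s1)"
      unfolding s2_def using step.hyps by (intro F_setv) simp
    also have "F (Suc k) s1 = F k s"
      using F_step[of k s] step by (simp add: s1_def fun_upd_idem)
    finally have eq: "setv i (int (Suc n)) (F (Suc k) s2) = setv i (int (Suc n)) (F k s)" .
    have "bval ?b s" using step by simp
    note w = exec.WhileTrue[OF this c u(2), unfolded eq]
    have "Suc n - k = Suc (Suc n - Suc k)" using step.hyps by simp
    then have "1 + bcost ?b + (t + 6) + u \<le> 8 + (Suc n - k) * (cost n p + 14)"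
      using t(1) u(1) by simp
    then show ?case using w by blast
  qed
  have "setv i 0 s i 0 = int 0" "setv i 0 s ''n'' 0 = int n"
    using i Loop.prems by simp_all
  from loop[of 0 "setv i 0 s", OF le0 this] obtain t where t: "t \<le> 8 + Suc n * (cost n p + 14)"
    "exec (While ?b ?c) (setv i 0 s) t (setv i (int (Suc n)) (F 0 (setv i 0 s)))"
    by auto
  have "exec (Write i (Const 0) (Const 0)) s 3 (setv i 0 s)"
    using exec.Write[of i "Const 0" "Const 0" s] by (simp add: eval_nat_numeral)
  from exec.Seq[OF this t(2)] have "exec (compile (Loop i p)) s (3 + t) (sem n (Loop i p) s)"
    by (simp only: compile.simps sem.simps F_setv[of 0, OF le0] flip: F_def)
  moreover have "3 + t \<le> cost n (Loop i p)" using t(1) by simp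
  ultimately show ?case by blast
qed

section \<open>Running time from the nesting depth of loops\<close>

primrec depth :: "prog \<Rightarrow> nat" where
  "depth (Assign x a b) = 0"
| "depth (p ;; q) = max (depth p) (depth q)"
| "depth (Branch b p q) = max (depth p) (depth q)"
| "depth Pass = 0"
| "depth (Loop i p) = Suc (depth p)"

text \<open>With base \<open>Suc n\<close>, which is at least 1, powers increase with the depth, so
  the bounds of subprograms can be raised to a common exponent even at \<open>n = 0\<close>.\<close>

lemma cost_le: "\<exists>K. \<forall>n. cost n p \<le> K * Suc n ^ depth p"
proof (induction p)
  case (Then p q)
  then obtain K K' where K: "cost n p \<le> K * Suc n ^ depth p" "cost n q \<le> K' * Suc n ^ depth q" for n
    by blast
  have "cost n (p ;; q) \<le> (K + K') * Suc n ^ depth (p ;; q)" for n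
  proof -
    have "K * Suc n ^ depth p \<le> K * Suc n ^ depth (p ;; q)"
      "K' * Suc n ^ depth q \<le> K' * Suc n ^ depth (p ;; q)"
      by (intro mult_le_mono2 power_increasing; simp)+
    then show ?thesis
      using K[of n] add_mult_distrib[of K K' "Suc n ^ depth (p ;; q)"] unfolding cost.simps by linarith
  qed
  then show ?case by blast
next
  case (Branch b p q)
  then obtain K K' where K: "cost n p \<le> K * Suc n ^ depth p" "cost n q \<le> K' * Suc n ^ depth q" for n
    by blast
  have "cost n (Branch b p q) \<le> (1 + bcost b + K + K') * Suc n ^ depth (Branch b p q)" for n
  proof -
    have "K * Suc n ^ depth p \<le> K * Suc n ^ depth (Branch b p q)"
      "K' * Suc n ^ depth q \<le> K' * Suc n ^ depth (Branch b p q)"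
      by (intro mult_le_mono2 power_increasing; simp)+
    moreover have "(1 + bcost b) * 1 \<le> (1 + bcost b) * Suc n ^ depth (Branch b p q)"
      by (intro mult_le_mono2 one_le_power) simp
    ultimately show ?thesis using K[of n] unfolding add_mult_distrib cost.simps by linarith
  qed
  then show ?case by blast
next
  case (Loop i p)
  then obtain K where K: "cost n p \<le> K * Suc n ^ depth p" for n
    by blast
  have "cost n (Loop i p) \<le> (25 + K) * Suc n ^ depth (Loop i p)" for n
  proof -
    have "cost n (Loop i p) \<le> Suc n * (cost n p + 25)" by simp
    also have "\<dots> \<le> Suc n * (K * Suc n ^ depth p + 25 * Suc n ^ depth p)"
      using K[of n] by (intro mult_le_mono2 add_le_mono) simp_all
    finally show ?thesis by (simp add: algebra_simps)
  qed
  then show ?case by blast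
qed (auto intro: exI[of _ 1])

lemma cost_bigo: "(\<lambda>n. real (cost n p)) \<in> O(\<lambda>n. real n ^ depth p)"
proof -
  obtain K where K: "cost n p \<le> K * Suc n ^ depth p" for n using cost_le by blast
  have "real (cost n p) \<le> real (K * 2 ^ depth p) * real n ^ depth p" if "1 \<le> n" for n
  proof -
    have "Suc n ^ depth p \<le> (2 * n) ^ depth p" using that by (intro power_mono) auto
    then have "K * Suc n ^ depth p \<le> K * 2 ^ depth p * n ^ depth p"
      by (simp add: power_mult_distrib mult.assoc del: power_Suc)
    then have "cost n p \<le> K * 2 ^ depth p * n ^ depth p" using K[of n] by (rule order.trans[rotated])
    then have "real (cost n p) \<le> real (K * 2 ^ depth p * n ^ depth p)" by (simp only: of_nat_le_iff)
    then show ?thesis by simp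
  qed
  then show ?thesis
    by (intro bigoI[of _ "real (K * 2 ^ depth p)"] eventually_sequentiallyI[of 1]) simp
qed

section \<open>Invariant rule for loops\<close>

text \<open>\<open>I k\<close> holds before round \<open>k\<close>. The separate \<open>Q\<close>
  describes the state after the last write to the counter.\<close>

lemma sem_Loop:
  assumes "I 0 s"
    and "\<And>k s. k \<le> n \<Longrightarrow> I k s \<Longrightarrow> I (Suc k) (sem n p (setv i (int k) s))"
    and "\<And>s. I (Suc n) s \<Longrightarrow> Q (setv i (int (Suc n)) s)"
  shows "Q (sem n (Loop i p) s)"
proof -
  define f where "f k s = sem n p (setv i (int k) s)" for k s
  define st where "st m = fold f [0..<m] s" for m
  have "I m (st m)" if "m \<le> Suc n" for m
    using that assms(1,2) by (induction m) (simp_all add: st_def f_def)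
  then have "I (Suc n) (st (Suc n))" by simp
  from assms(3)[OF this] show ?thesis unfolding st_def f_def sem.simps .
qed

section \<open>The program\<close>

text \<open>
  \<open>L\<close> marks the remaining vertices, and cell \<open>pos n u c\<close> of \<open>out\<close> holds the coefficient of \<open>x\<^sup>c\<close> in the
  polynomial of \<open>u\<close>.  As twins are contracted into the smaller one, vertex \<open>0\<close> remains to the end, and the
  answer is found in cell \<open>0\<close> of \<open>out\<close>.  \<open>T\<close> is the table of the coefficients of \<open>B(x\<^sup>a, x\<^sup>b)\<close>.
\<close>

definition pos :: "nat \<Rightarrow> int \<Rightarrow> int \<Rightarrow> int" where
  "pos n a b = a * (int n + 1) + b"

text \<open>Division by \<open>n + 1\<close> recovers the row. The row may be any integer, so
  nesting \<open>pos\<close> also gives distinct addresses in the three-dimensional table.\<close>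

lemma pos_eq_iff [simp]:
  assumes "b \<le> n" "b' \<le> n"
  shows "pos n a (int b) = pos n a' (int b') \<longleftrightarrow> a = a' \<and> b = b'"
proof
  assume eq: "pos n a (int b) = pos n a' (int b')"
  have "pos n x (int y) div (int n + 1) = x" if "y \<le> n" for x y
    using that div_pos_pos_trivial[of "int y" "int n + 1"] by (simp add: pos_def)
  then have "a = a'" using assms eq by metis
  then show "a = a' \<and> b = b'" using eq by (simp add: pos_def)
qed simp

lemma pos_0 [simp]: "pos n 0 b = b"
  by (simp add: pos_def)

definition cell :: "aexp \<Rightarrow> aexp \<Rightarrow> aexp" where
  "cell a b = Add (Mul a (Add (var ''n'') (Const 1))) b"

lemma aval_cell: "s ''n'' 0 = int n \<Longrightarrow> aval (cell a b) s = pos n (aval a s) (aval b s)"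
  by (simp add: cell_def pos_def)

abbreviation adj :: "vname \<Rightarrow> vname \<Rightarrow> aexp" where
  "adj u v \<equiv> Read ''A'' (Add (Mul (var ''n'') (var u)) (var v))"

definition agree :: "vname set \<Rightarrow> state \<Rightarrow> state \<Rightarrow> bool" where
  "agree X s t \<longleftrightarrow> (\<forall>x. x \<notin> X \<longrightarrow> s x = t x)"

lemma agree_refl [simp]: "agree X s s"
  by (simp add: agree_def)

lemma agree_upd [simp]: "x \<in> X \<Longrightarrow> agree X (s(x := f)) t \<longleftrightarrow> agree X s t"
  by (auto simp: agree_def)

lemma agreeD: "agree X s t \<Longrightarrow> x \<notin> X \<Longrightarrow> s x = t x"
  by (simp add: agree_def)

text \<open>
  For \<open>b = 0\<close> the first summand reads a cell outside the intended row, but it is multiplied by \<open>b\<close>.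
\<close>

definition table_step :: prog where
  "table_step =
    Branch (Equal (var ''a'') (Const 0))
      (Branch (Equal (var ''b'') (var ''c''))
        (Assign ''T'' (cell (cell (var ''a'') (var ''b'')) (var ''c'')) (Const 1))
        (Assign ''T'' (cell (cell (var ''a'') (var ''b'')) (var ''c'')) (Const 0)))
      (Assign ''T'' (cell (cell (var ''a'') (var ''b'')) (var ''c''))
        (Mul (Mul (var ''e'') (var ''b''))
          (Read ''T'' (cell (cell (Sub (var ''a'') (Const 1)) (Sub (var ''b'') (Const 1))) (var ''c'')))) ;;
       Branch (Equal (var ''c'') (Const 0)) Pass
        (Assign ''T'' (cell (cell (var ''a'') (var ''b'')) (var ''c''))
          (Add (Read ''T'' (cell (cell (var ''a'') (var ''b'')) (var ''c'')))
            (Read ''T'' (cell (cell (Sub (var ''a'') (Const 1)) (var ''b'')) (Sub (var ''c'') (Const 1)))))))"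

lemma mods_table_step: "mods table_step = {''T''}"
  by (simp add: table_step_def)

definition table :: prog where
  "table = Loop ''a'' (Loop ''b'' (Loop ''c'' table_step))"

text \<open>The cells that precede \<open>(a, b, c)\<close> lexicographically are filled. A cell
  depends only on cells with first index \<open>a - 1\<close>, so its inputs are ready.\<close>

definition table_inv :: "nat \<Rightarrow> int \<Rightarrow> nat \<Rightarrow> nat \<Rightarrow> nat \<Rightarrow> state \<Rightarrow> bool" where
  "table_inv n e a b c s \<longleftrightarrow> s ''n'' 0 = int n \<and> s ''e'' 0 = e \<and>
    (\<forall>a' b' c'. b' \<le> n \<longrightarrow> c' \<le> n \<longrightarrow> a' < a \<or> a' = a \<and> (b' < b \<or> b' = b \<and> c' < c) \<longrightarrow>
      s ''T'' (pos n (pos n (int a') (int b')) (int c')) = merge_coeff e a' b' c')"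

lemma table_inv_setv [simp]:
  "x \<notin> {''n'', ''e'', ''T''} \<Longrightarrow> table_inv n e a b c (s(x := f)) \<longleftrightarrow> table_inv n e a b c s"
  by (auto simp: table_inv_def)

text \<open>Used for the carry at the end of an inner loop: \<open>(a, b, n + 1)\<close> and
  \<open>(a, b + 1, 0)\<close> describe the same filled cells.\<close>

lemma table_inv_mono:
  assumes "table_inv n e a b c s"
    and "\<And>a' b' c'. b' \<le> n \<Longrightarrow> c' \<le> n \<Longrightarrow> a' < a2 \<or> a' = a2 \<and> (b' < b2 \<or> b' = b2 \<and> c' < c2) \<Longrightarrow>
      a' < a \<or> a' = a \<and> (b' < b \<or> b' = b \<and> c' < c)"
  shows "table_inv n e a2 b2 c2 s"
  unfolding table_inv_def
proof (intro conjI allI impI)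
  fix a' b' c'
  assume "b' \<le> n" "c' \<le> n" "a' < a2 \<or> a' = a2 \<and> (b' < b2 \<or> b' = b2 \<and> c' < c2)"
  then show "s ''T'' (pos n (pos n (int a') (int b')) (int c')) = merge_coeff e a' b' c'"
    using assms(1) assms(2)[of b' c' a'] unfolding table_inv_def by blast
qed (use assms(1) in \<open>simp_all add: table_inv_def\<close>)

lemma table_inv_upd:
  assumes "table_inv n e a b c s" "b \<le> n" "c \<le> n" "val = merge_coeff e a b c"
  shows "table_inv n e a b (Suc c) (s(''T'' := (s ''T'')(pos n (pos n (int a) (int b)) (int c) := val)))"
  using assms by (auto simp: table_inv_def less_Suc_eq)

lemma table_step_sem:
  assumes inv: "table_inv n e a b c s" and le: "b \<le> n" "c \<le> n"
    and v: "s ''a'' 0 = int a" "s ''b'' 0 = int b" "s ''c'' 0 = int c"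
  shows "table_inv n e a b (Suc c) (sem n table_step s)"
proof -
  let ?p = "pos n (pos n (int a) (int b)) (int c)"
  have n: "s ''n'' 0 = int n" and e: "s ''e'' 0 = e" using inv by (auto simp: table_inv_def)
  have "sem n table_step s = s(''T'' := (s ''T'')(?p := merge_coeff e a b c))"
  proof (cases a)
    case 0
    then show ?thesis
      by (auto simp: table_step_def aval_cell n v merge_coeff_0)
  next
    case (Suc a')
    have T: "s ''T'' (pos n (pos n (int a') (int b')) (int c')) = merge_coeff e a' b' c'"
      if "b' \<le> n" "c' \<le> n" for b' c'
      using inv that Suc by (simp add: table_inv_def)
    have 1: "int b * s ''T'' (pos n (pos n (int a') (int b - 1)) (int c)) = int b * merge_coeff e a' (b - 1) c"
      using T[of "b - 1" c] le by (cases b) auto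
    have 2: "s ''T'' (pos n (pos n (int a') (int b)) (int c - 1)) = merge_coeff e a' b (c - 1)" if "c \<noteq> 0"
      using T[of b "c - 1"] le that by (cases c) auto
    \<comment> \<open>The second summand is read after the target cell has been overwritten, so it
      must sit in a different cell.\<close>
    have 3: "pos n (pos n (int a') (int b)) (int c - 1) \<noteq> ?p" if "c \<noteq> 0"
      using le that Suc pos_eq_iff[of "c - 1" n c] by (cases c) auto
    show ?thesis
      using 1 2 3 Suc
      by (auto simp: table_step_def aval_cell n e v merge_coeff_Suc mult.assoc)
  qed
  then show ?thesis using table_inv_upd[OF inv le refl] by simp
qed

lemma table_sem:
  assumes "s ''n'' 0 = int n" "s ''e'' 0 = e" "a \<le> n" "b \<le> n" "c \<le> n"
  shows "sem n table s ''T'' (pos n (pos n (int a) (int b)) (int c)) = merge_coeff e a b c"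
proof -
  have "table_inv n e (Suc n) 0 0 (sem n table s)"
    unfolding table_def
  proof (rule sem_Loop[where I = "\<lambda>a. table_inv n e a 0 0" and Q = "table_inv n e (Suc n) 0 0"])
    show "table_inv n e 0 0 0 s" using assms by (simp add: table_inv_def)
    show "table_inv n e (Suc a) 0 0 (sem n (Loop ''b'' (Loop ''c'' table_step)) (setv ''a'' (int a) s))"
      if "table_inv n e a 0 0 s" for a s
    proof (rule sem_Loop[where Q = "table_inv n e (Suc a) 0 0" and
          I = "\<lambda>b s. table_inv n e a b 0 s \<and> s ''a'' 0 = int a"])
      show "table_inv n e a 0 0 (setv ''a'' (int a) s) \<and> setv ''a'' (int a) s ''a'' 0 = int a"
        using that by simp
      show "table_inv n e a (Suc b) 0 (sem n (Loop ''c'' table_step) (setv ''b'' (int b) s)) \<and>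
          sem n (Loop ''c'' table_step) (setv ''b'' (int b) s) ''a'' 0 = int a"
        if "b \<le> n" "table_inv n e a b 0 s \<and> s ''a'' 0 = int a" for b s
      proof
        show "table_inv n e a (Suc b) 0 (sem n (Loop ''c'' table_step) (setv ''b'' (int b) s))"
        proof (rule sem_Loop[where Q = "table_inv n e a (Suc b) 0" and
              I = "\<lambda>c s. table_inv n e a b c s \<and> s ''a'' 0 = int a \<and> s ''b'' 0 = int b"])
          show "table_inv n e a b (Suc c) (sem n table_step (setv ''c'' (int c) s)) \<and>
              sem n table_step (setv ''c'' (int c) s) ''a'' 0 = int a \<and>
              sem n table_step (setv ''c'' (int c) s) ''b'' 0 = int b"
            if "c \<le> n" "table_inv n e a b c s \<and> s ''a'' 0 = int a \<and> s ''b'' 0 = int b" for c s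
            using that \<open>b \<le> n\<close> by (auto intro!: table_step_sem simp: sem_frame mods_table_step)
          show "table_inv n e a (Suc b) 0 (setv ''c'' (int (Suc n)) s)"
            if "table_inv n e a b (Suc n) s \<and> s ''a'' 0 = int a \<and> s ''b'' 0 = int b" for s
            using that by (auto intro: table_inv_mono)
        qed (use that in simp)
        show "sem n (Loop ''c'' table_step) (setv ''b'' (int b) s) ''a'' 0 = int a"
          using that by (simp add: sem_frame mods_table_step del: sem.simps)
      qed
      show "table_inv n e (Suc a) 0 0 (setv ''b'' (int (Suc n)) s)"
        if "table_inv n e a (Suc n) 0 s \<and> s ''a'' 0 = int a" for s
        using that by (auto intro: table_inv_mono)
    qed
  qed simp
  then show ?thesis using assms by (simp add: table_inv_def)
qed

section \<open>Contraction of a pair of twins\<close>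

text \<open>The new coefficients are collected in \<open>''W''\<close>, because every one of them
  still reads the old rows of \<open>''U''\<close> and \<open>''V''\<close> in
  \<open>''out''\<close>.\<close>

definition combine :: prog where
  "combine = Loop ''c'' (Assign ''W'' (var ''c'') (Const 0) ;;
    Loop ''a'' (Loop ''b'' (Assign ''W'' (var ''c'')
      (Add (Read ''W'' (var ''c''))
        (Mul (Mul (Read ''out'' (cell (var ''U'') (var ''a''))) (Read ''out'' (cell (var ''V'') (var ''b''))))
          (Read ''T'' (cell (cell (var ''a'') (var ''b'')) (var ''c''))))))))"

lemma combine_sem:
  assumes n: "s0 ''n'' 0 = int n" and "c \<le> n"
  shows "sem n combine s0 ''W'' (int c) =
    (\<Sum>a\<le>n. \<Sum>b\<le>n. s0 ''out'' (pos n (s0 ''U'' 0) (int a)) * s0 ''out'' (pos n (s0 ''V'' 0) (int b)) *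
      s0 ''T'' (pos n (pos n (int a) (int b)) (int c)))"
proof -
  define g where "g c a b = s0 ''out'' (pos n (s0 ''U'' 0) (int a)) * s0 ''out'' (pos n (s0 ''V'' 0) (int b)) *
      s0 ''T'' (pos n (pos n (int a) (int b)) (int c))" for a b c
  let ?ag = "\<lambda>s. agree {''a'', ''b'', ''c'', ''W''} s s0"
  define I where "I c s \<longleftrightarrow> ?ag s \<and> (\<forall>c'<c. s ''W'' (int c') = (\<Sum>a<Suc n. \<Sum>b<Suc n. g c' a b))" for c s
  have "I (Suc n) (sem n combine s0)"
    unfolding combine_def
  proof (rule sem_Loop[where I = I and Q = "I (Suc n)"])
    fix c s
    assume s: "I c s"
    let ?add = "Assign ''W'' (var ''c'')
      (Add (Read ''W'' (var ''c''))
        (Mul (Mul (Read ''out'' (cell (var ''U'') (var ''a''))) (Read ''out'' (cell (var ''V'') (var ''b''))))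
          (Read ''T'' (cell (cell (var ''a'') (var ''b'')) (var ''c'')))))"
    define Ia where "Ia a s \<longleftrightarrow> I c s \<and> s ''c'' 0 = int c \<and>
      s ''W'' (int c) = (\<Sum>a'<a. \<Sum>b<Suc n. g c a' b)" for a s
    \<comment> \<open>The accumulator holds the completed values of \<open>a\<close> and the begun
      sum over \<open>b\<close>.\<close>
    define Ib where "Ib a b s \<longleftrightarrow> I c s \<and> s ''c'' 0 = int c \<and> s ''a'' 0 = int a \<and>
      s ''W'' (int c) = (\<Sum>a'<a. \<Sum>b<Suc n. g c a' b) + (\<Sum>b'<b. g c a b')" for a b s
    have body: "Ib a (Suc b) (sem n ?add (setv ''b'' (int b) s))" if "Ib a b s" for a b s
    proof -
      have "?ag s" using that by (simp add: Ib_def I_def)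
      then have "s ''n'' = s0 ''n''" "s ''U'' = s0 ''U''" "s ''V'' = s0 ''V''" "s ''out'' = s0 ''out''"
        "s ''T'' = s0 ''T''" by (auto intro!: agreeD)
      then show ?thesis using that by (simp add: Ib_def I_def g_def aval_cell n)
    qed
    have row: "Ia (Suc a) (sem n (Loop ''b'' ?add) (setv ''a'' (int a) s))" if "Ia a s" for a s
    proof (rule sem_Loop[where I = "Ib a" and Q = "Ia (Suc a)"])
      show "Ib a 0 (setv ''a'' (int a) s)" using that by (simp add: Ia_def Ib_def I_def)
      show "Ia (Suc a) (setv ''b'' (int (Suc n)) s)" if "Ib a (Suc n) s" for s
        using that by (simp add: Ia_def Ib_def I_def)
    qed (rule body)
    have "I (Suc c) (sem n (Loop ''a'' (Loop ''b'' ?add)) (sem n (Assign ''W'' (var ''c'') (Const 0)) (setv ''c'' (int c) s)))"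
    proof (rule sem_Loop[where I = Ia and Q = "I (Suc c)"])
      show "Ia 0 (sem n (Assign ''W'' (var ''c'') (Const 0)) (setv ''c'' (int c) s))"
        using s by (simp add: Ia_def I_def)
      show "I (Suc c) (setv ''a'' (int (Suc n)) s)" if "Ia (Suc n) s" for s
        using that by (auto simp: Ia_def I_def less_Suc_eq)
    qed (rule row)
    then show "I (Suc c) (sem n (Assign ''W'' (var ''c'') (Const 0) ;; Loop ''a'' (Loop ''b'' ?add))
        (setv ''c'' (int c) s))"
      unfolding sem.simps(2) .
  qed (simp_all add: I_def)
  then show ?thesis
    using \<open>c \<le> n\<close> unfolding I_def g_def by (simp only: lessThan_Suc_atMost less_Suc_eq_le)
qed

definition store :: prog where
  "store = Loop ''c'' (Assign ''out'' (cell (var ''U'') (var ''c'')) (Read ''W'' (var ''c'')))"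

lemma store_sem:
  assumes n: "s0 ''n'' 0 = int n" and U: "s0 ''U'' 0 = int U" and "c \<le> n"
  shows "sem n store s0 ''out'' (pos n (int u) (int c)) =
    (if u = U then s0 ''W'' (int c) else s0 ''out'' (pos n (int u) (int c)))"
proof -
  define I where "I k s \<longleftrightarrow> agree {''c'', ''out''} s s0 \<and>
    (\<forall>u c. c \<le> n \<longrightarrow> s ''out'' (pos n (int u) (int c)) =
      (if u = U \<and> c < k then s0 ''W'' (int c) else s0 ''out'' (pos n (int u) (int c))))" for k s
  have "I (Suc n) (sem n store s0)"
    unfolding store_def
  proof (rule sem_Loop[where I = I and Q = "I (Suc n)"])
    fix k s
    assume "k \<le> n" and I: "I k s"
    then have "s ''n'' = s0 ''n''" "s ''U'' = s0 ''U''" "s ''W'' = s0 ''W''"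
      by (auto simp: I_def intro!: agreeD)
    then show "I (Suc k) (sem n (Assign ''out'' (cell (var ''U'') (var ''c'')) (Read ''W'' (var ''c'')))
        (setv ''c'' (int k) s))"
      using I \<open>k \<le> n\<close> by (auto simp: I_def aval_cell n U less_Suc_eq)
  qed (auto simp: I_def)
  then show ?thesis using \<open>c \<le> n\<close> by (simp add: I_def)
qed

text \<open>The adjacency of the representatives \<open>''U''\<close> and \<open>''V''\<close>
  decides whether their whole modules are joined. The row of \<open>''V''\<close> stays in
  \<open>''out''\<close>, but \<open>''V''\<close> loses its mark.\<close>

definition contract :: prog where
  "contract = Assign ''e'' (Const 0) (adj ''U'' ''V'') ;; table ;; combine ;; store ;;
    Assign ''L'' (var ''V'') (Const 0)"

lemma mods_contract: "mods contract \<subseteq> {''a'', ''b'', ''c'', ''e'', ''T'', ''W'', ''out'', ''L''}"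
  by (simp add: contract_def table_def table_step_def combine_def store_def)

lemma contract_sem:
  assumes n: "s ''n'' 0 = int n" and U: "s ''U'' 0 = int U" and V: "s ''V'' 0 = int V"
  shows "sem n contract s ''L'' = (s ''L'')(int V := 0)"
    and "c \<le> n \<Longrightarrow> sem n contract s ''out'' (pos n (int u) (int c)) =
      (if u = U then \<Sum>a\<le>n. \<Sum>b\<le>n. s ''out'' (pos n (int U) (int a)) * s ''out'' (pos n (int V) (int b)) *
          merge_coeff (s ''A'' (int (n * U + V))) a b c
       else s ''out'' (pos n (int u) (int c)))"
proof -
  define s1 where "s1 = sem n (Assign ''e'' (Const 0) (adj ''U'' ''V'')) s"
  define s2 where "s2 = sem n table s1"
  define s3 where "s3 = sem n combine s2"
  define s4 where "s4 = sem n store s3"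
  have s: "sem n contract s = sem n (Assign ''L'' (var ''V'') (Const 0)) s4"
    unfolding contract_def s1_def s2_def s3_def s4_def by (simp only: sem.simps(2))
  have 1: "s1 = s(''e'' := (s ''e'')(0 := s ''A'' (int (n * U + V))))"
    by (simp add: s1_def n U V)
  have 2: "s2 x = s1 x" if "x \<notin> {''a'', ''b'', ''c'', ''T''}" for x
    unfolding s2_def using that by (intro sem_frame) (simp add: table_def table_step_def)
  have 3: "s3 x = s2 x" if "x \<notin> {''a'', ''b'', ''c'', ''W''}" for x
    unfolding s3_def using that by (intro sem_frame) (simp add: combine_def)
  have 4: "s4 x = s3 x" if "x \<notin> {''c'', ''out''}" for x
    unfolding s4_def using that by (intro sem_frame) (simp add: store_def)
  show "sem n contract s ''L'' = (s ''L'')(int V := 0)"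
    by (simp add: s V 1 2 3 4)
  assume c: "c \<le> n"
  have "s2 ''T'' (pos n (pos n (int a) (int b)) (int c)) = merge_coeff (s ''A'' (int (n * U + V))) a b c"
    if "a \<le> n" "b \<le> n" for a b
    unfolding s2_def using that c by (intro table_sem) (simp_all add: 1 n)
  then have "s3 ''W'' (int c) = (\<Sum>a\<le>n. \<Sum>b\<le>n. s ''out'' (pos n (int U) (int a)) * s ''out'' (pos n (int V) (int b)) *
          merge_coeff (s ''A'' (int (n * U + V))) a b c)"
    unfolding s3_def using c by (subst combine_sem) (simp_all add: 1 2 n U V)
  moreover have "s4 ''out'' (pos n (int u) (int c)) =
      (if u = U then s3 ''W'' (int c) else s3 ''out'' (pos n (int u) (int c)))"
    unfolding s4_def using c by (intro store_sem) (simp_all add: 1 2 3 n U)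
  ultimately show "sem n contract s ''out'' (pos n (int u) (int c)) =
      (if u = U then \<Sum>a\<le>n. \<Sum>b\<le>n. s ''out'' (pos n (int U) (int a)) * s ''out'' (pos n (int V) (int b)) *
          merge_coeff (s ''A'' (int (n * U + V))) a b c
       else s ''out'' (pos n (int u) (int c)))"
    by (simp add: s 1 2 3)
qed

section \<open>Search for twins\<close>

definition twin_test :: prog where
  "twin_test = Assign ''ok'' (Const 0) (Const 1) ;;
    Loop ''w'' (Branch
      (Conj (Equal (Read ''L'' (var ''w'')) (Const 1))
        (Conj (Neg (Equal (var ''w'') (var ''u'')))
          (Conj (Neg (Equal (var ''w'') (var ''v''))) (Neg (Equal (adj ''u'' ''w'') (adj ''v'' ''w''))))))
      (Assign ''ok'' (Const 0) (Const 0)) Pass)"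

definition same_row :: "nat \<Rightarrow> state \<Rightarrow> nat \<Rightarrow> nat \<Rightarrow> nat \<Rightarrow> bool" where
  "same_row n s u v w \<longleftrightarrow> (s ''L'' (int w) = 1 \<and> w \<noteq> u \<and> w \<noteq> v \<longrightarrow>
    s ''A'' (int (n * u + w)) = s ''A'' (int (n * v + w)))"

lemma twin_test_sem:
  assumes n: "s0 ''n'' 0 = int n" and u: "s0 ''u'' 0 = int u" and v: "s0 ''v'' 0 = int v"
  shows "sem n twin_test s0 ''ok'' 0 = of_bool (\<forall>w\<le>n. same_row n s0 u v w)"
proof -
  define I where "I k s \<longleftrightarrow> agree {''w'', ''ok''} s s0 \<and>
    s ''ok'' 0 = of_bool (\<forall>w<k. same_row n s0 u v w)" for k s
  have "I (Suc n) (sem n twin_test s0)"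
    unfolding twin_test_def sem.simps(2)
  proof (rule sem_Loop[where I = I and Q = "I (Suc n)"])
    fix k s
    assume I: "I k s"
    then have "s ''n'' = s0 ''n''" "s ''u'' = s0 ''u''" "s ''v'' = s0 ''v''" "s ''A'' = s0 ''A''" "s ''L'' = s0 ''L''"
      by (auto simp: I_def intro!: agreeD)
    then show "I (Suc k) (sem n (Branch
      (Conj (Equal (Read ''L'' (var ''w'')) (Const 1))
        (Conj (Neg (Equal (var ''w'') (var ''u'')))
          (Conj (Neg (Equal (var ''w'') (var ''v''))) (Neg (Equal (adj ''u'' ''w'') (adj ''v'' ''w''))))))
      (Assign ''ok'' (Const 0) (Const 0)) Pass) (setv ''w'' (int k) s))"
      using I by (auto simp: I_def n u v same_row_def less_Suc_eq)
  qed (simp_all add: I_def)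
  then show ?thesis by (simp add: I_def less_Suc_eq_le)
qed

definition visit_pair :: prog where
  "visit_pair = Branch
    (Conj (Equal (Read ''L'' (var ''u'')) (Const 1))
      (Conj (Equal (Read ''L'' (var ''v'')) (Const 1)) (Less (var ''u'') (var ''v''))))
    (twin_test ;;
     Branch (Equal (var ''ok'') (Const 1))
      (Assign ''found'' (Const 0) (Const 1) ;; Assign ''U'' (Const 0) (var ''u'') ;;
       Assign ''V'' (Const 0) (var ''v''))
      Pass)
    Pass"

text \<open>There is no early exit: a later pair overwrites an earlier one, and any pair of twins
  will do.\<close>

definition search :: prog where
  "search = Assign ''found'' (Const 0) (Const 0) ;; Loop ''u'' (Loop ''v'' visit_pair)"

definition twin_rows :: "nat \<Rightarrow> state \<Rightarrow> nat \<Rightarrow> nat \<Rightarrow> bool" where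
  "twin_rows n s u v \<longleftrightarrow> s ''L'' (int u) = 1 \<and> s ''L'' (int v) = 1 \<and> u < v \<and> (\<forall>w\<le>n. same_row n s u v w)"

abbreviation search_vars :: "vname set" where
  "search_vars \<equiv> {''u'', ''v'', ''w'', ''ok'', ''found'', ''U'', ''V''}"

text \<open>Twins are judged in the initial state \<open>s0\<close>, since the search changes
  neither the marks nor the adjacency matrix. Pairs are visited in lexicographic order.\<close>

definition search_inv :: "nat \<Rightarrow> state \<Rightarrow> nat \<Rightarrow> nat \<Rightarrow> state \<Rightarrow> bool" where
  "search_inv n s0 u v s \<longleftrightarrow> agree search_vars s s0 \<and>
    (s ''found'' 0 = 1 \<and> (\<exists>U V. U \<le> n \<and> V \<le> n \<and> s ''U'' 0 = int U \<and> s ''V'' 0 = int V \<and> twin_rows n s0 U V) \<or>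
     s ''found'' 0 = 0 \<and> (\<forall>u' v'. v' \<le> n \<longrightarrow> u' < u \<or> u' = u \<and> v' < v \<longrightarrow> \<not> twin_rows n s0 u' v'))"

lemma search_inv_setv [simp]:
  "x = ''u'' \<or> x = ''v'' \<Longrightarrow> search_inv n s0 u v (s(x := f)) \<longleftrightarrow> search_inv n s0 u v s"
  by (auto simp: search_inv_def)

lemma search_inv_mono:
  assumes "search_inv n s0 u v s"
    and "\<And>u' v'. v' \<le> n \<Longrightarrow> u' < u2 \<or> u' = u2 \<and> v' < v2 \<Longrightarrow> u' < u \<or> u' = u \<and> v' < v"
  shows "search_inv n s0 u2 v2 s"
proof -
  have "\<forall>u' v'. v' \<le> n \<longrightarrow> u' < u2 \<or> u' = u2 \<and> v' < v2 \<longrightarrow> u' < u \<or> u' = u \<and> v' < v"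
    using assms(2) by blast
  then show ?thesis using assms(1) unfolding search_inv_def by blast
qed

lemma mods_visit_pair: "mods visit_pair = search_vars - {''u'', ''v''}"
  by (auto simp: visit_pair_def twin_test_def)

lemma visit_pair_sem:
  assumes inv: "search_inv n s0 u v s" and n: "s0 ''n'' 0 = int n" and le: "u \<le> n" "v \<le> n"
    and u: "s ''u'' 0 = int u" and v: "s ''v'' 0 = int v"
  shows "search_inv n s0 u (Suc v) (sem n visit_pair s)"
proof -
  have ag: "agree search_vars s s0" using inv by (simp add: search_inv_def)
  then have eq: "s ''n'' = s0 ''n''" "s ''A'' = s0 ''A''" "s ''L'' = s0 ''L''"
    by (auto intro!: agreeD)
  define t where "t = sem n twin_test s"
  have t: "t x = s x" if "x \<notin> {''w'', ''ok''}" for x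
    unfolding t_def using that by (intro sem_frame) (simp add: twin_test_def)
  have ok: "t ''ok'' 0 = of_bool (\<forall>w\<le>n. same_row n s0 u v w)"
    using twin_test_sem[of s n u v] by (simp add: t_def eq n u v same_row_def)
  have agt: "agree search_vars t s0"
    using ag t by (auto simp: agree_def)
  show ?thesis
  proof (cases "twin_rows n s0 u v")
    case True
    then have "sem n visit_pair s = t(''found'' := (t ''found'')(0 := 1), ''U'' := (t ''U'')(0 := int u), ''V'' := (t ''V'')(0 := int v))"
      using ok by (simp add: visit_pair_def eq u v twin_rows_def t flip: t_def)
    then show ?thesis using True le agt by (auto simp: search_inv_def)
  next
    case False
    then have "sem n visit_pair s = t \<or> sem n visit_pair s = s"
      using ok by (auto simp: visit_pair_def eq u v twin_rows_def t simp flip: t_def)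
    moreover have "search_inv n s0 u v t"
      using inv agt t[of "''found''"] t[of "''U''"] t[of "''V''"] unfolding search_inv_def by simp
    ultimately have "search_inv n s0 u v (sem n visit_pair s)" using inv by metis
    then show ?thesis using False unfolding search_inv_def less_Suc_eq by blast
  qed
qed

lemma search_sem:
  assumes n: "s0 ''n'' 0 = int n"
  shows "search_inv n s0 (Suc n) 0 (sem n search s0)"
  unfolding search_def sem.simps(2)
proof (rule sem_Loop[where I = "\<lambda>u. search_inv n s0 u 0" and Q = "search_inv n s0 (Suc n) 0"])
  fix u s
  assume u: "u \<le> n" "search_inv n s0 u 0 s"
  show "search_inv n s0 (Suc u) 0 (sem n (Loop ''v'' visit_pair) (setv ''u'' (int u) s))"
  proof (rule sem_Loop[where Q = "search_inv n s0 (Suc u) 0" and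
        I = "\<lambda>v s. search_inv n s0 u v s \<and> s ''u'' 0 = int u"])
    show "search_inv n s0 u 0 (setv ''u'' (int u) s) \<and> setv ''u'' (int u) s ''u'' 0 = int u"
      using u by simp
    fix v s
    assume v: "v \<le> n" "search_inv n s0 u v s \<and> s ''u'' 0 = int u"
    then show "search_inv n s0 u (Suc v) (sem n visit_pair (setv ''v'' (int v) s)) \<and>
        sem n visit_pair (setv ''v'' (int v) s) ''u'' 0 = int u"
      using u n by (auto intro!: visit_pair_sem simp: sem_frame mods_visit_pair)
  next
    show "search_inv n s0 (Suc u) 0 (setv ''v'' (int (Suc n)) s)"
      if "search_inv n s0 u (Suc n) s \<and> s ''u'' 0 = int u" for s
      using that by (auto intro: search_inv_mono)
  qed
qed (simp_all add: search_inv_def)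

section \<open>Correctness\<close>

definition contract_twins :: prog where
  "contract_twins = search ;; Branch (Equal (var ''found'') (Const 1)) contract Pass"

text \<open>A single vertex has the polynomial \<open>x\<close>, hence the entry 1 in column 1. The
  loop also marks the spurious vertex \<open>n\<close>; the last assignment removes that
  mark.\<close>

definition initialise :: prog where
  "initialise = Loop ''u'' (Assign ''L'' (var ''u'') (Const 1) ;;
      Assign ''out'' (cell (var ''u'') (Const 1)) (Const 1)) ;;
    Assign ''L'' (var ''n'') (Const 0)"

definition matching_prog :: prog where
  "matching_prog = initialise ;; Loop ''k'' contract_twins"

text \<open>
  \<open>X\<close> is the set of remaining vertices, and \<open>r x\<close> is the vertex into which \<open>x\<close> has been contracted.
\<close>

definition quotient_inv :: "nat \<Rightarrow> nat set set \<Rightarrow> nat set \<Rightarrow> (nat \<Rightarrow> nat) \<Rightarrow> state \<Rightarrow> bool" where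
  "quotient_inv n E X r s \<longleftrightarrow> s ''n'' 0 = int n \<and>
    (\<forall>i<n. \<forall>j<n. s ''A'' (int (n * i + j)) = of_bool ({i, j} \<in> E)) \<and>
    (\<forall>u\<le>n. s ''L'' (int u) = of_bool (u \<in> X)) \<and>
    X \<subseteq> {..<n} \<and> 0 \<in> X \<and> (\<forall>x<n. r x \<in> X) \<and> (\<forall>u\<in>X. r u = u) \<and>
    (\<forall>x<n. \<forall>y<n. r x \<noteq> r y \<longrightarrow> ({x, y} \<in> E \<longleftrightarrow> {r x, r y} \<in> E)) \<and>
    (\<forall>u\<in>X. \<forall>c\<le>n. s ''out'' (pos n (int u) (int c)) = coeff (matching_poly E {x. x < n \<and> r x = u}) c)"

lemma quotient_inv_cong:
  assumes "quotient_inv n E X r s" "agree Y s' s" "Y \<inter> {''n'', ''A'', ''L'', ''out''} = {}"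
  shows "quotient_inv n E X r s'"
proof -
  have "s' x = s x" if "x \<in> {''n'', ''A'', ''L'', ''out''}" for x
    using that assms(2,3) agreeD[of Y s' s x] by blast
  then show ?thesis using assms(1) by (simp add: quotient_inv_def)
qed

lemma twin_rows_iff:
  assumes inv: "quotient_inv n E X r s" and "u \<le> n" "v \<le> n"
  shows "twin_rows n s u v \<longleftrightarrow> twins E X u v \<and> u < v"
proof -
  have L: "s ''L'' (int w) = of_bool (w \<in> X)" if "w \<le> n" for w
    using that inv by (simp add: quotient_inv_def)
  have X: "w < n" if "w \<in> X" for w using that inv by (auto simp: quotient_inv_def)
  have A: "s ''A'' (int (n * i + j)) = of_bool ({i, j} \<in> E)" if "i < n" "j < n" for i j
    using that inv by (simp add: quotient_inv_def)
  have row: "same_row n s u v w \<longleftrightarrow> (w \<in> X - {u, v} \<longrightarrow> ({u, w} \<in> E \<longleftrightarrow> {v, w} \<in> E))"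
    if "u \<in> X" "v \<in> X" "w \<le> n" for w
    using that X[of u] X[of v] X[of w] A[of u w] A[of v w] L[of w] by (auto simp: same_row_def)
  show ?thesis
    using L[of u] L[of v] assms(2,3) row X unfolding twin_rows_def twins_def
    by (metis (no_types, opaque_lifting) DiffD1 less_imp_le of_bool_eq_iff of_bool_eq(2))
qed

text \<open>As \<open>U\<close> and \<open>V\<close> are twins in \<open>X\<close>, renaming
  \<open>V\<close> to \<open>U\<close> preserves adjacency to every other representative. The new
  class of \<open>U\<close> is the union of two classes that are completely joined or not joined at
  all, so its polynomial comes from \<open>matching_poly_Un\<close>.\<close>

lemma quotient_inv_contract:
  assumes E: "\<forall>e\<in>E. card e = 2" and inv: "quotient_inv n E X r s"
    and tw: "twins E X U V" "U < V"
    and U: "s ''U'' 0 = int U" and V: "s ''V'' 0 = int V"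
  shows "quotient_inv n E (X - {V}) (\<lambda>x. if r x = V then U else r x) (sem n contract s)"
proof -
  let ?s = "sem n contract s"
  let ?r = "\<lambda>x. if r x = V then U else r x"
  let ?S = "\<lambda>u. {x. x < n \<and> r x = u}"
  have n: "s ''n'' 0 = int n" using inv by (simp add: quotient_inv_def)
  note contract = contract_sem[of s n U V, OF n U V]
  have A: "s ''A'' (int (n * i + j)) = of_bool ({i, j} \<in> E)" if "i < n" "j < n" for i j
    using that inv by (simp add: quotient_inv_def)
  have X: "X \<subseteq> {..<n}" "0 \<in> X" "\<And>x. x < n \<Longrightarrow> r x \<in> X" "\<And>u. u \<in> X \<Longrightarrow> r u = u"
    and L: "\<And>u. u \<le> n \<Longrightarrow> s ''L'' (int u) = of_bool (u \<in> X)"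
    and mod: "\<And>x y. x < n \<Longrightarrow> y < n \<Longrightarrow> r x \<noteq> r y \<Longrightarrow> {x, y} \<in> E \<longleftrightarrow> {r x, r y} \<in> E"
    and out: "\<And>u c. u \<in> X \<Longrightarrow> c \<le> n \<Longrightarrow> s ''out'' (pos n (int u) (int c)) = coeff (matching_poly E (?S u)) c"
    using inv unfolding quotient_inv_def by blast+
  have UV: "U \<in> X" "V \<in> X" "U < n" "V < n" and row: "\<And>w. w \<in> X \<Longrightarrow> w \<noteq> U \<Longrightarrow> w \<noteq> V \<Longrightarrow> {U, w} \<in> E \<longleftrightarrow> {V, w} \<in> E"
    using tw X(1) by (auto simp: twins_def)
  have "?s ''n'' = s ''n''" "?s ''A'' = s ''A''"
    using mods_contract by (auto intro!: sem_frame)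
  moreover have "?s ''L'' (int u) = of_bool (u \<in> X - {V})" if "u \<le> n" for u
    using that L by (auto simp: contract(1))
  moreover have "{x, y} \<in> E \<longleftrightarrow> {?r x, ?r y} \<in> E" if "x < n" "y < n" "?r x \<noteq> ?r y" for x y
  proof -
    have rX: "r x \<in> X" "r y \<in> X" using X(3) that by simp_all
    have "{r x, r y} \<in> E \<longleftrightarrow> {?r x, ?r y} \<in> E"
    proof (cases "r x = V")
      case True
      then have "r y \<noteq> U" "r y \<noteq> V" using that(3) by (simp_all split: if_splits)
      then show ?thesis using row[OF rX(2)] True by simp
    next
      case False
      show ?thesis
      proof (cases "r y = V")
        case True
        then have "r x \<noteq> U" using False that(3) by simp
        then show ?thesis using row[OF rX(1)] True False
          by (simp add: insert_commute[of "r x"])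
      qed (simp add: False)
    qed
    moreover have "r x \<noteq> r y" using that(3) by metis
    ultimately show ?thesis using mod[OF that(1,2)] by simp
  qed
  moreover have "?s ''out'' (pos n (int u) (int c)) = coeff (matching_poly E {x. x < n \<and> ?r x = u}) c"
    if "u \<in> X - {V}" "c \<le> n" for u c
  proof (cases "u = U")
    case False
    then have "{x. x < n \<and> ?r x = u} = ?S u" using that by auto
    then show ?thesis using False that out[of u c] by (simp add: contract(2))
  next
    case True
    have eq: "{x. x < n \<and> ?r x = U} = ?S U \<union> ?S V" using tw(2) by auto
    \<comment> \<open>Cutting the sums off at exponent \<open>n\<close> therefore loses no
      coefficient.\<close>
    have deg: "degree (matching_poly E (?S u)) \<le> n" for u
    proof -
      have "card (?S u) \<le> card {..<n}" by (intro card_mono) auto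
      then show ?thesis using degree_matching_poly[of "?S u" E] by simp
    qed
    have "matching_poly E (?S U \<union> ?S V) =
        merge (of_bool ({U, V} \<in> E)) (matching_poly E (?S U)) (matching_poly E (?S V))"
      using mod tw(2) by (intro matching_poly_Un[OF E]) auto
    then show ?thesis
      unfolding True eq using that out[of U] out[of V] UV A[of U V]
      by (simp add: contract(2) coeff_merge[OF deg deg])
  qed
  \<comment> \<open>The larger twin is removed, so vertex 0 always survives.\<close>
  moreover have "0 \<in> X - {V}" using X(2) tw(2) by simp
  ultimately show ?thesis
    unfolding quotient_inv_def using n A X(1,3,4) UV tw(2) by auto
qed

text \<open>A successful search removes one vertex. A failing search shows that at most one vertex
  is left, which is why the bound has the form of a maximum with 1.\<close>

lemma quotient_inv_contract_twins:
  assumes E: "\<forall>e\<in>E. card e = 2" and inv: "quotient_inv n E X r s"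
    and ex: "1 < card X \<Longrightarrow> \<exists>u v. u \<noteq> v \<and> twins E X u v"
  shows "\<exists>X' r'. quotient_inv n E X' r' (sem n contract_twins s) \<and> card X' \<le> max 1 (card X - 1)"
proof -
  define t where "t = sem n search s"
  have "search_inv n s (Suc n) 0 t"
    unfolding t_def using inv by (intro search_sem) (simp add: quotient_inv_def)
  then have ag: "agree search_vars t s" and
    cases: "t ''found'' 0 = 1 \<and> (\<exists>U V. U \<le> n \<and> V \<le> n \<and> t ''U'' 0 = int U \<and> t ''V'' 0 = int V \<and> twin_rows n s U V) \<or>
     t ''found'' 0 = 0 \<and> (\<forall>u v. v \<le> n \<longrightarrow> u < Suc n \<longrightarrow> \<not> twin_rows n s u v)"
    unfolding search_inv_def by blast+
  have invt: "quotient_inv n E X r t"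
    using inv ag by (rule quotient_inv_cong) simp
  have X: "X \<subseteq> {..<n}" using inv by (simp add: quotient_inv_def)
  from cases show ?thesis
  proof (elim disjE conjE exE)
    fix U V
    assume f: "t ''found'' 0 = 1" and UV: "U \<le> n" "V \<le> n" "t ''U'' 0 = int U" "t ''V'' 0 = int V" "twin_rows n s U V"
    then have tw: "twins E X U V" "U < V" using twin_rows_iff[OF inv] by auto
    then have "V \<in> X" by (simp add: twins_def)
    then have "card (X - {V}) = card X - 1" by (simp add: card_Diff_singleton)
    moreover have "sem n contract_twins s = sem n contract t"
      by (simp add: contract_twins_def f flip: t_def)
    ultimately show ?thesis
      using quotient_inv_contract[OF E invt tw UV(3,4)] by (metis max.cobounded2)
  next
    assume f: "t ''found'' 0 = 0" and none: "\<forall>u v. v \<le> n \<longrightarrow> u < Suc n \<longrightarrow> \<not> twin_rows n s u v"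
    have "\<not> 1 < card X"
    proof
      assume "1 < card X"
      then obtain u v where uv: "u \<noteq> v" "twins E X u v" using ex by blast
      then have "u \<le> n" "v \<le> n" using X by (auto simp: twins_def)
      \<comment> \<open>The search considers only increasing pairs, so the twins may have to be
        swapped.\<close>
      then show False
        using none uv twins_commute[of E X u v] twin_rows_iff[OF inv, of u v] twin_rows_iff[OF inv, of v u]
        by (metis less_Suc_eq_le linorder_neqE_nat)
    qed
    moreover have "sem n contract_twins s = t"
      by (simp add: contract_twins_def f flip: t_def)
    ultimately show ?thesis using invt by (intro exI[of _ X] exI[of _ r]) auto
  qed
qed

lemma matching_poly_singleton:
  assumes "\<forall>e\<in>E. card e = 2"
  shows "matching_poly E {v} = monom 1 1"
  using matching_poly_rec[OF assms, of "{v}" v] matching_poly_empty[OF assms] by simp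

lemma input_state_A:
  assumes "i < n" "j < n"
  shows "input_state n G ''A'' (int (n * i + j)) = of_bool ({i, j} \<in> edges G)"
proof -
  have "i' = i \<and> j' = j" if "int (n * i + j) = int (n * i' + j')" "j' < n" for i' j'
  proof -
    have "n * i + j = n * i' + j'" using that(1) by (simp only: of_nat_eq_iff)
    moreover have "(n * x + y) div n = x" "(n * x + y) mod n = y" if "y < n" for x y
      using that by simp_all
    ultimately show ?thesis using that(2) assms(2) by metis
  qed
  then show ?thesis using assms unfolding input_state_def by auto
qed

lemma quotient_inv_initialise:
  assumes E: "\<forall>e\<in>edges G. card e = 2" and "0 < n"
  shows "quotient_inv n (edges G) {..<n} id (sem n initialise (input_state n G))"
proof -
  let ?p = "Assign ''L'' (var ''u'') (Const 1) ;; Assign ''out'' (cell (var ''u'') (Const 1)) (Const 1)"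
  define I where "I k s \<longleftrightarrow> agree {''u'', ''L'', ''out''} s (input_state n G) \<and>
    (\<forall>u<k. s ''L'' (int u) = 1) \<and>
    (\<forall>u c. c \<le> n \<longrightarrow> s ''out'' (pos n (int u) (int c)) = of_bool (u < k \<and> c = 1))" for k s
  define t where "t = sem n (Loop ''u'' ?p) (input_state n G)"
  have in_n: "input_state n G ''n'' 0 = int n" by (simp add: input_state_def)
  have "I (Suc n) t"
    unfolding t_def
  proof (rule sem_Loop[where I = I and Q = "I (Suc n)"])
    show "I 0 (input_state n G)" by (simp add: I_def) (simp add: input_state_def)
    show "I (Suc k) (sem n ?p (setv ''u'' (int k) s))" if "k \<le> n" "I k s" for k s
    proof -
      have "s ''n'' = input_state n G ''n''"
        using that by (auto simp: I_def intro!: agreeD)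
      then show ?thesis
        \<comment> \<open>Column 1 exists only because \<open>n\<close> is positive.\<close>
        using that \<open>0 < n\<close> pos_eq_iff[of _ n 1] by (auto simp: I_def aval_cell in_n less_Suc_eq)
    qed
  qed (simp add: I_def)
  then have ag: "agree {''u'', ''L'', ''out''} t (input_state n G)"
    and L: "\<And>u. u \<le> n \<Longrightarrow> t ''L'' (int u) = 1"
    and out: "\<And>u c. u < n \<Longrightarrow> c \<le> n \<Longrightarrow> t ''out'' (pos n (int u) (int c)) = of_bool (c = 1)"
    by (auto simp: I_def)
  have t: "t ''n'' = input_state n G ''n''" "t ''A'' = input_state n G ''A''"
    using ag by (auto intro!: agreeD)
  have "sem n initialise (input_state n G) = t(''L'' := (t ''L'')(int n := 0))"
    by (simp add: initialise_def t in_n del: sem.simps(5) flip: t_def)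
  moreover have "{x. x < n \<and> id x = u} = {u}" if "u < n" for u
    using that by auto
  ultimately show ?thesis
    using \<open>0 < n\<close> L out
    by (auto simp: quotient_inv_def t in_n input_state_A[simplified] matching_poly_singleton[OF E])
qed

text \<open>After \<open>k\<close> rounds at most \<open>max 1 (n - k)\<close> vertices remain. At
  the end only vertex 0 is left and its class is the whole vertex set, so cell 0 of
  \<open>''out''\<close> is the constant coefficient for \<open>G\<close>.\<close>

lemma matching_prog_sem:
  assumes G: "cograph G" and V: "verts G = {..<n}"
  shows "output_value (sem n matching_prog (input_state n G)) = int (num_perfect_matchings G)"
proof -
  note wf = cograph_wf[OF G]
  have E: "\<forall>e\<in>edges G. card e = 2" using wf by blast
  have "0 < n" using wf V by auto
  let ?I = "\<lambda>k s. \<exists>X r. quotient_inv n (edges G) X r s \<and> card X \<le> max 1 (n - k)"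
  have setv: "?I k (setv ''k'' j s)" if "?I k s" for k j s
    using that by (auto simp: quotient_inv_def)
  have "?I (Suc n) (sem n matching_prog (input_state n G))"
    unfolding matching_prog_def sem.simps(2)
  proof (rule sem_Loop[where I = ?I and Q = "?I (Suc n)"])
    show "?I 0 (sem n initialise (input_state n G))"
      using quotient_inv_initialise[OF E \<open>0 < n\<close>] by (intro exI[of _ "{..<n}"] exI[of _ id]) simp
    show "?I (Suc k) (sem n contract_twins (setv ''k'' (int k) s))" if "?I k s" for k s
    proof -
      note I = that
      obtain X r where X: "quotient_inv n (edges G) X r (setv ''k'' (int k) s)" "card X \<le> max 1 (n - k)"
        using setv[OF I] by blast
      then have "X \<subseteq> verts G" by (simp add: quotient_inv_def V)
      then obtain X' r' where "quotient_inv n (edges G) X' r' (sem n contract_twins (setv ''k'' (int k) s))"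
        "card X' \<le> max 1 (card X - 1)"
        using quotient_inv_contract_twins[OF E X(1)] cograph_has_twins[OF G] by blast
      moreover from this X(2) have "card X' \<le> max 1 (n - Suc k)" by linarith
      ultimately show ?thesis by blast
    qed
  qed (rule setv)
  then obtain X r where inv: "quotient_inv n (edges G) X r (sem n matching_prog (input_state n G))"
    and "card X \<le> 1" by auto
  moreover have "0 \<in> X" "X \<subseteq> {..<n}" using inv by (auto simp: quotient_inv_def)
  moreover from this have "finite X" by (simp add: finite_subset)
  ultimately have X: "X = {0}"
    by (metis card_le_Suc0_iff_eq One_nat_def insertE singletonD subsetI subset_antisym empty_subsetI insert_subset insertI1)
  then have "{x. x < n \<and> r x = 0} = {..<n}" using inv by (auto simp: quotient_inv_def)
  moreover have "sem n matching_prog (input_state n G) ''out'' (pos n (int 0) (int 0)) =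
      coeff (matching_poly (edges G) {x. x < n \<and> r x = 0}) 0"
    using inv X unfolding quotient_inv_def by blast
  ultimately show ?thesis
    using num_perfect_matchings_eq[of G] wf V by (simp add: output_value_def)
qed

text \<open>The loop over rounds contains three nested loops: over \<open>''u''\<close>,
  \<open>''v''\<close>, \<open>''w''\<close> in the search, and over \<open>''a''\<close>,
  \<open>''b''\<close>, \<open>''c''\<close> in the table and in the combination.\<close>

lemma depth_matching_prog: "depth matching_prog = 4"
  by (simp add: matching_prog_def initialise_def contract_twins_def contract_def search_def visit_pair_def
      twin_test_def store_def combine_def table_def table_step_def)

theorem mainTheorem5:
  "\<exists>(p :: com) (T :: nat \<Rightarrow> nat).
     (\<lambda>n. real (T n)) \<in> O(\<lambda>n. real n ^ 4) \<and>
     (\<forall>(n :: nat) (G :: nat graph). cograph G \<and> verts G = {..<n} \<longrightarrow>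
        (\<exists>t s. exec p (input_state n G) t s \<and> t \<le> T n \<and>
               output_value s = int (num_perfect_matchings G)))"
proof (rule exI[of _ "compile matching_prog"], rule exI[of _ "\<lambda>n. cost n matching_prog"],
    intro conjI allI impI)
  show "(\<lambda>n. real (cost n matching_prog)) \<in> O(\<lambda>n. real n ^ 4)"
    using cost_bigo[of matching_prog] by (simp only: depth_matching_prog)
next
  fix n and G :: "nat graph"
  assume G: "cograph G \<and> verts G = {..<n}"
  have "wf_prog matching_prog"
    by (simp add: matching_prog_def initialise_def contract_twins_def contract_def search_def visit_pair_def
      twin_test_def store_def combine_def table_def table_step_def)
  then obtain t where t: "t \<le> cost n matching_prog"
    "exec (compile matching_prog) (input_state n G) t (sem n matching_prog (input_state n G))"
    using exec_compile[of matching_prog "input_state n G" n] by (auto simp: input_state_def)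
  then show "\<exists>t s. exec (compile matching_prog) (input_state n G) t s \<and> t \<le> cost n matching_prog \<and>
      output_value s = int (num_perfect_matchings G)"
    using matching_prog_sem[of G n] G by blast
qed

end
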